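(* Let $\Omega\subset\mathbb R^d$ be a bounded open set with $C^\infty$ boundary (or the cube $[0,1]^d$), let $L>0$, $n\in\mathbb Z_+$, and $X=\overline\Omega\times[-L,L]^n$. Let $\widehat p:\mathcal P(X)\times\overline\Omega\to[-L,L]^n$ be a map which is uniformly continuous in $\mu$ (with respect to $W_1$) and uniformly Lipschitz in $x$, such that the in-context map $\widehat\Gamma:\mathcal P(X)\times X\to X$, $\widehat\Gamma(\mu,(x,y))=(x,\widehat p(\mu,x))$, is continuous, and let $G_{\widehat\Gamma}(\mu)=\widehat\Gamma(\mu,\cdot)_\#\mu$. Then for every $\varepsilon\in(0,1)$ there exist $J\in\mathbb Z_+$, $y_0\in[-L,L]^n$, softmax self-attention in-context maps $\Gamma_{\theta_\ell}:\mathcal P(\mathbb R^d\times\mathbb R^{d_\ell})\times(\mathbb R^d\times\mathbb R^{d_\ell})\to\mathbb R^d\times\mathbb R^{d'_\ell}$ and MLP maps $F_{\xi_\ell}:\mathbb R^d\times\mathbb R^{d'_\ell}\to\mathbb R^d\times\mathbb R^{d_{\ell+1}}$ ($\ell=1,\dots,J$), of the forms described in the context, with $d_1=n$, $d_\ell=4d+4n$ for $\ell=2,\dots,J$, $d_{J+1}=n$ and $d'_\ell=4d+4n$ for $\ell=1,\dots,J$, such that the in-context map $$\Gamma^{\rm tran}(\mu,(x,y)):=\big(F_{\xi_J}\diamond\Gamma_{\theta_J}\diamond\cdots\diamond F_{\xi_1}\diamond\Gamma_{\theta_1}\big)(\mu,(x,y_0))$$ and the measure map $G_{\Gamma^{\rm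 tran}}(\mu):=\Gamma^{\rm tran}(\mu,\cdot)_\#\mu$, $G_{\Gamma^{\rm tran}}:\mathcal P(X)\to\mathcal P(X)$, satisfy $$\sup_{\mu\in\mathcal P(X)}W_1\big(G_{\Gamma^{\rm tran}}(\mu),G_{\widehat\Gamma}(\mu)\big)\le\varepsilon .$$ In particular there is a sequence of such transformers $G_{\Gamma^{\rm tran}_m}$ converging to $G_{\widehat\Gamma}$ uniformly in $W_1$ on $\mathcal P(X)$ as $m\to\infty$. Moreover $\Gamma^{\rm tran}(\mu,(x,y))=(x,\Gamma^{(y)}_{\rm tran}(\mu,x))$, where $\Gamma^{(y)}_{\rm tran}(\mu,x)$ does not depend on $y$.
   Context: $\mathcal P(Y)$ denotes Borel probability measures on $Y$, equipped with the 1-Wasserstein distance $W_1$; $F_\#\mu(B)=\mu(F^{-1}(B))$ is the pushforward. Coordinates on $\mathbb R^{d+d'}$ are $z=(x,y)$ and $\pi_d(x,y)=x$. A multi-head softmax self-attention in-context map $\Gamma_\theta:\mathcal P(\mathbb R^{d+d'})\times\mathbb R^{d+d'}\to\mathbb R^{d+d''}$ with parameters $\theta=\{Q^h,K^h,V^h,W^L,W^h\}_{h=1}^H$ ($Q^h,K^h\in\mathbb R^{k\times(d+d')}$, $V^h\in\mathbb R^{d_{\rm head}\times(d+d')}$, $W^h\in\mathbb R^{d''\times d_{\rm head}}$, $W^L\in\mathbb R^{d''\times(d+d')}$) is $$\Gamma_\theta(\mu,z)=\Big(\pi_d(z),\ W^Lz+\sum_{h=1}^H W^h\int\frac{\exp(\tfrac{1}{\sqrt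 k}\langle Q^hz,K^hz'\rangle)}{\int\exp(\tfrac{1}{\sqrt k}\langle Q^hz,K^hz''\rangle)\,d\mu(z'')}V^hz'\,d\mu(z')\Big).$$ An MLP map has the form $F_\xi(z)=(\pi_d(z),H_\xi(z))$ with $H_\xi:\mathbb R^{d+d'}\to\mathbb R^{d''}$ a multilayer perceptron; it is regarded as the in-context map $(\mu,z)\mapsto F_\xi(z)$. The composition of in-context maps is $(\Gamma_2\diamond\Gamma_1)(\mu,z)=\Gamma_2(\nu,\Gamma_1(\mu,z))$ with $\nu=\Gamma_1(\mu,\cdot)_\#\mu$. *)

theory Defs
  imports "HOL-Probability.Probability"
begin

text \<open>A point of \<open>R^(d+m)\<close> is represented as a pair \<open>(x, y)\<close> with \<open>x :: real^'d\<close>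
  (the first d coordinates, d = CARD('d)) and \<open>y :: nat \<Rightarrow> real\<close>, of which only the
  coordinates \<open>y 0, ..., y (m-1)\<close> are meaningful (the others are zero for all vectors
  produced by the maps below).  Thus \<open>\<pi>_d = fst\<close>.\<close>

type_synonym 'd pt = "(real^'d) \<times> (nat \<Rightarrow> real)"

definition ydist :: "nat \<Rightarrow> (nat \<Rightarrow> real) \<Rightarrow> (nat \<Rightarrow> real) \<Rightarrow> real" where
  "ydist n y y' = sqrt (\<Sum>i<n. (y i - y' i)\<^sup>2)"

definition pdist :: "nat \<Rightarrow> 'd::finite pt \<Rightarrow> 'd pt \<Rightarrow> real" where
  "pdist n z z' = sqrt ((norm (fst z - fst z'))\<^sup>2 + (\<Sum>i<n. (snd z i - snd z' i)\<^sup>2))"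

definition Ybox :: "nat \<Rightarrow> real \<Rightarrow> (nat \<Rightarrow> real) set" where
  "Ybox n L = {y. (\<forall>i<n. \<bar>y i\<bar> \<le> L) \<and> (\<forall>i\<ge>n. y i = 0)}"

definition Xset :: "(real^'d::finite) set \<Rightarrow> nat \<Rightarrow> real \<Rightarrow> 'd pt set" where
  "Xset \<Omega> n L = closure \<Omega> \<times> Ybox n L"

definition PX :: "'d::finite pt set \<Rightarrow> 'd pt measure set" where
  "PX X = {\<mu>. prob_space \<mu> \<and> sets \<mu> = sets borel \<and> emeasure \<mu> X = 1}"

definition couplings :: "'d::finite pt measure \<Rightarrow> 'd pt measure \<Rightarrow> ('d pt \<times> 'd pt) measure set" where
  "couplings \<mu> \<nu> = {\<pi>. sets \<pi> = sets (borel \<Otimes>\<^sub>M borel) \<and> prob_space \<pi> \<and>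
      distr \<pi> borel fst = \<mu> \<and> distr \<pi> borel snd = \<nu>}"

definition W1 :: "nat \<Rightarrow> 'd::finite pt measure \<Rightarrow> 'd pt measure \<Rightarrow> ennreal" where
  "W1 n \<mu> \<nu> = (INF \<pi>\<in>couplings \<mu> \<nu>. \<integral>\<^sup>+ p. ennreal (pdist n (fst p) (snd p)) \<partial>\<pi>)"

text \<open>Pushforward of a measure on X (the map only needs to be defined on X).\<close>

definition pushX :: "'d::finite pt set \<Rightarrow> 'd pt measure \<Rightarrow> ('d pt \<Rightarrow> 'd pt) \<Rightarrow> 'd pt measure" where
  "pushX X \<mu> F = distr (restrict_space \<mu> X) borel F"

fun Ck :: "nat \<Rightarrow> (real^'d::finite) set \<Rightarrow> (real^'d \<Rightarrow> real) \<Rightarrow> bool" where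
  "Ck 0 U f = continuous_on U f"
| "Ck (Suc k) U f = (f differentiable_on U \<and>
      (\<forall>v\<in>Basis. Ck k U (\<lambda>x. frechet_derivative f (at x) v)))"

definition smooth_on :: "(real^'d::finite) set \<Rightarrow> (real^'d \<Rightarrow> real) \<Rightarrow> bool" where
  "smooth_on U f = (\<forall>k. Ck k U f)"

definition smooth_boundary :: "(real^'d::finite) set \<Rightarrow> bool" where
  "smooth_boundary \<Omega> = (\<forall>p\<in>frontier \<Omega>. \<exists>U \<rho>. open U \<and> p \<in> U \<and> smooth_on U \<rho> \<and>
      (\<forall>x\<in>U. frechet_derivative \<rho> (at x) \<noteq> (\<lambda>v. 0)) \<and>
      \<Omega> \<inter> U = {x\<in>U. \<rho> x < 0})"

text \<open>A \<open>r \<times> (d+m)\<close> matrix in block form \<open>[A | B]\<close>, applied to \<open>(x,y)\<close>.\<close>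

type_synonym 'd bmat = "(nat \<Rightarrow> 'd \<Rightarrow> real) \<times> (nat \<Rightarrow> nat \<Rightarrow> real)"

definition bmv :: "nat \<Rightarrow> nat \<Rightarrow> 'd::finite bmat \<Rightarrow> 'd pt \<Rightarrow> (nat \<Rightarrow> real)" where
  "bmv r m M z = (\<lambda>i. if i < r then (\<Sum>j\<in>UNIV. fst M i j * fst z $ j) + (\<Sum>j<m. snd M i j * snd z j) else 0)"

definition ip :: "nat \<Rightarrow> (nat \<Rightarrow> real) \<Rightarrow> (nat \<Rightarrow> real) \<Rightarrow> real" where
  "ip k u v = (\<Sum>i<k. u i * v i)"

record 'd attn_par =
  nheads :: nat
  kdim :: nat
  hdim :: nat
  Qm :: "nat \<Rightarrow> 'd bmat"
  Km :: "nat \<Rightarrow> 'd bmat"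
  Vm :: "nat \<Rightarrow> 'd bmat"
  WLm :: "'d bmat"
  Wm :: "nat \<Rightarrow> nat \<Rightarrow> nat \<Rightarrow> real"

definition attn_weight :: "nat \<Rightarrow> 'd::finite attn_par \<Rightarrow> nat \<Rightarrow> 'd pt measure \<Rightarrow> 'd pt \<Rightarrow> 'd pt \<Rightarrow> real" where
  "attn_weight m \<theta> h \<mu> z z' =
     exp (ip (kdim \<theta>) (bmv (kdim \<theta>) m (Qm \<theta> h) z) (bmv (kdim \<theta>) m (Km \<theta> h) z') / sqrt (kdim \<theta>)) /
     (\<integral>z''. exp (ip (kdim \<theta>) (bmv (kdim \<theta>) m (Qm \<theta> h) z) (bmv (kdim \<theta>) m (Km \<theta> h) z'') / sqrt (kdim \<theta>)) \<partial>\<mu>)"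

definition attn :: "nat \<Rightarrow> nat \<Rightarrow> 'd::finite attn_par \<Rightarrow> 'd pt measure \<Rightarrow> 'd pt \<Rightarrow> 'd pt" where
  "attn m m'' \<theta> \<mu> z = (fst z, \<lambda>i. if i < m'' then
      bmv m'' m (WLm \<theta>) z i +
      (\<Sum>h<nheads \<theta>. \<Sum>j<hdim \<theta>. Wm \<theta> h i j *
          (\<integral>z'. attn_weight m \<theta> h \<mu> z z' * bmv (hdim \<theta>) m (Vm \<theta> h) z' j \<partial>\<mu>))
    else 0)"

text \<open>Multilayer perceptron with ReLU activation.  Parameters: width w1 and weights
  (block matrix, bias) of the first affine layer, followed by a list of affine layers
  (output width, weight matrix, bias); ReLU is applied between consecutive affine layers.\<close>

definition relu :: "(nat \<Rightarrow> real) \<Rightarrow> (nat \<Rightarrow> real)" where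
  "relu v = (\<lambda>i. max 0 (v i))"

fun mlp_net :: "nat \<Rightarrow> (nat \<times> (nat \<Rightarrow> nat \<Rightarrow> real) \<times> (nat \<Rightarrow> real)) list \<Rightarrow> (nat \<Rightarrow> real) \<Rightarrow> (nat \<Rightarrow> real)" where
  "mlp_net c [] v = v"
| "mlp_net c ((r, W, b) # ls) v =
     mlp_net r ls (\<lambda>i. if i < r then (\<Sum>j<c. W i j * relu v j) + b i else 0)"

type_synonym 'd mlp_par = "nat \<times> 'd bmat \<times> (nat \<Rightarrow> real) \<times> (nat \<times> (nat \<Rightarrow> nat \<Rightarrow> real) \<times> (nat \<Rightarrow> real)) list"

definition mlp :: "nat \<Rightarrow> nat \<Rightarrow> 'd::finite mlp_par \<Rightarrow> 'd pt \<Rightarrow> 'd pt" where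
  "mlp m m'' \<xi> z = (case \<xi> of (w1, A, b, ls) \<Rightarrow>
     (fst z, \<lambda>i. if i < m'' then
        mlp_net w1 ls (\<lambda>j. if j < w1 then bmv w1 m A z j + b j else 0) i else 0))"

definition ic_comp :: "('d::finite pt measure \<Rightarrow> 'd pt \<Rightarrow> 'd pt) \<Rightarrow> ('d pt measure \<Rightarrow> 'd pt \<Rightarrow> 'd pt)
    \<Rightarrow> ('d pt measure \<Rightarrow> 'd pt \<Rightarrow> 'd pt)" (infixr "\<diamondop>" 65) where
  "(\<Gamma>2 \<diamondop> \<Gamma>1) \<mu> z = \<Gamma>2 (distr \<mu> borel (\<Gamma>1 \<mu>)) (\<Gamma>1 \<mu> z)"

fun tstack :: "(nat \<Rightarrow> nat) \<Rightarrow> (nat \<Rightarrow> nat) \<Rightarrow> (nat \<Rightarrow> 'd::finite attn_par) \<Rightarrow> (nat \<Rightarrow> 'd mlp_par)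
    \<Rightarrow> nat \<Rightarrow> 'd pt measure \<Rightarrow> 'd pt \<Rightarrow> 'd pt" where
  "tstack din dmid \<theta> \<xi> 0 = (\<lambda>\<mu> z. z)"
| "tstack din dmid \<theta> \<xi> (Suc l) =
     (\<lambda>\<mu>. mlp (dmid (Suc l)) (din (Suc (Suc l))) (\<xi> (Suc l))) \<diamondop>
     (attn (din (Suc l)) (dmid (Suc l)) (\<theta> (Suc l)) \<diamondop> tstack din dmid \<theta> \<xi> l)"

end

theory Submission
  imports Defs
begin

text \<open>Uniform attention (\<open>Q = 0\<close>) computes context means exactly, so a stack of layers can read off, one
  after the other, finitely many statistics \<open>\<integral> \<phi>\<^sub>k d\<mu>\<close> with \<open>\<phi>\<^sub>k\<close> a ReLU partition of unity.
  Closeness of these statistics forces closeness in \<open>W\<^sub>1\<close>: keep the common mass inside each cell and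
  transport the small excess arbitrarily.  Hence \<open>\<rho>((\<mu>, x), (\<nu>, x')) = |x - x'|\<^sub>1 + \<Sum>\<^sub>k |\<integral> \<phi>\<^sub>k d\<mu> - \<integral> \<phi>\<^sub>k d\<nu>|\<close>
  controls the modulus of continuity of \<open>p\<close>, and for a finite \<open>\<rho>\<close>-net \<open>(q\<^sub>j)\<close> and large \<open>K\<close> the
  McShane-type maximum \<open>max\<^sub>j (p(q\<^sub>j) - K \<rho>(\<cdot>, q\<^sub>j))\<close> approximates \<open>p\<close> uniformly.  It involves only sums,
  absolute values and maxima, which ReLU networks compute exactly, and it can be accumulated
  term by term, so \<open>2n + 3\<close> token coordinates suffice whatever the number of statistics.\<close>

subsection \<open>Functions computed by ReLU networks\<close>

text \<open>In \<mu> only a modulus of continuity of p is available, with no Lipschitz bound with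
  respect to \<rho>. Hence the slope \<open>K = 2 * L / \<delta>\<close>: a net point at distance at
  least \<delta> contributes at most -L and cannot win the maximum. The net itself has to be much
  finer than \<delta>, so that a nearby point pays almost no penalty. The token width is fixed,
  while the number of statistics and of net points grows with the accuracy, so depth replaces width:
  no statistic is stored, and every distance to a net point is recomputed from zero and consumed at
  once. Since each statistic is a mean of a function of the original tokens, every token carries its
  own y through all intermediate layers. Attention with Q = 0 does not see the query, so y
  influences the output only through \<mu>; this is why y may be replaced by y0 in the query. Finite
  nets come from rounding finitely many bounded real features, which avoids any appeal to
  compactness of the space of measures.\<close>

inductive relu_fn :: "nat \<Rightarrow> ('d::finite pt \<Rightarrow> real) \<Rightarrow> bool" for m where
  relu_fn_fst: "relu_fn m (\<lambda>z. fst z $ j)"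
| relu_fn_snd: "i < m \<Longrightarrow> relu_fn m (\<lambda>z. snd z i)"
| relu_fn_const: "relu_fn m (\<lambda>z. c)"
| relu_fn_add: "relu_fn m f \<Longrightarrow> relu_fn m g \<Longrightarrow> relu_fn m (\<lambda>z. f z + g z)"
| relu_fn_cmult: "relu_fn m f \<Longrightarrow> relu_fn m (\<lambda>z. c * f z)"
| relu_fn_relu: "relu_fn m f \<Longrightarrow> relu_fn m (\<lambda>z. max 0 (f z))"

lemma relu_fn_diff: "relu_fn m f \<Longrightarrow> relu_fn m g \<Longrightarrow> relu_fn m (\<lambda>z. f z - g z)"
  using relu_fn_add[OF _ relu_fn_cmult[of m g "-1"], of f] by simp

lemma relu_fn_max: 
  assumes "relu_fn m f" "relu_fn m g" shows "relu_fn m (\<lambda>z. max (f z) (g z))"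
proof -
  have "(\<lambda>z. max (f z) (g z)) = (\<lambda>z. g z + max 0 (f z - g z))" by (auto simp: max_def)
  then show ?thesis by (simp add: relu_fn_add relu_fn_relu relu_fn_diff assms)
qed

lemma relu_fn_min: 
  assumes "relu_fn m f" "relu_fn m g" shows "relu_fn m (\<lambda>z. min (f z) (g z))"
proof -
  have "(\<lambda>z. min (f z) (g z)) = (\<lambda>z. g z - max 0 (g z - f z))" by (auto simp: max_def min_def)
  then show ?thesis by (simp add: relu_fn_relu relu_fn_diff assms)
qed

lemma relu_fn_abs: 
  assumes "relu_fn m f" shows "relu_fn m (\<lambda>z. \<bar>f z\<bar>)"
proof -
  have "(\<lambda>z. \<bar>f z\<bar>) = (\<lambda>z. max (f z) (0 - f z))" by (auto simp: max_def)
  then show ?thesis by (simp only: relu_fn_max relu_fn_diff relu_fn_const assms)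
qed

lemma relu_fn_sum:
  assumes "\<And>i. i \<in> I \<Longrightarrow> relu_fn m (f i)" shows "relu_fn m (\<lambda>z. \<Sum>i\<in>I. f i z)"
  using assms by (induction I rule: infinite_finite_induct) (auto intro: relu_fn_const relu_fn_add)

lemmas relu_fn_intros = relu_fn_fst relu_fn_snd relu_fn_const relu_fn_add relu_fn_cmult
  relu_fn_diff relu_fn_max relu_fn_min relu_fn_abs relu_fn_sum

text \<open>\<open>m\<close> bounds the cells that are read. Later cells may hold anything, so a
  statistic keeps its value when the token is truncated or overwritten there.\<close>

lemma relu_fn_cong:
  "relu_fn m f \<Longrightarrow> fst z = fst z' \<Longrightarrow> (\<And>i. i < m \<Longrightarrow> snd z i = snd z' i) \<Longrightarrow> f z = f z'"
  by (induction rule: relu_fn.induct) auto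

text \<open>In the token layout the original y starts at cell \<open>n + 2\<close>; a statistic
  written for plain tokens is re-read from there.\<close>

lemma relu_fn_shift:
  assumes "relu_fn m f" "k + m \<le> m'"
  shows "relu_fn m' (\<lambda>w. f (fst w, \<lambda>i. snd w (k + i)))"
  using assms by (induction rule: relu_fn.induct) (auto intro: relu_fn.intros)

lemma relu_fn_mono: "relu_fn m f \<Longrightarrow> m \<le> m' \<Longrightarrow> relu_fn m' f"
  using relu_fn_shift[of m f 0 m'] by simp

lemma continuous_on_relu_fn: "relu_fn m f \<Longrightarrow> continuous_on S f"
proof (induction rule: relu_fn.induct)
  case (relu_fn_snd i)
  have "continuous_on UNIV ((\<lambda>y::nat\<Rightarrow>real. y i) \<circ> snd)"
    by (intro continuous_on_compose continuous_on_snd continuous_on_id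
        continuous_on_subset[OF continuous_on_product_coordinates]) auto
  then show ?case by (auto simp: o_def intro: continuous_on_subset)
qed (intro continuous_intros | assumption)+

lemma borel_measurable_relu_fn [measurable (raw)]: 
  "relu_fn m f \<Longrightarrow> f \<in> borel_measurable borel"
  using continuous_on_relu_fn[of m f UNIV] by (rule borel_measurable_continuous_onI)

section \<open>Features with affine read-outs\<close>

text \<open>A set of functions instead of a weight matrix: that added features lose nothing becomes
  an inclusion of spans.\<close>

definition aff_span :: "nat \<Rightarrow> ('a \<Rightarrow> nat \<Rightarrow> real) \<Rightarrow> ('a \<Rightarrow> real) set" where
  "aff_span r F = {g. \<exists>c b. \<forall>z. g z = (\<Sum>j<r. c j * F z j) + b}"

lemma aff_spanI: "(\<And>z. g z = (\<Sum>j<r. c j * F z j) + b) \<Longrightarrow> g \<in> aff_span r F"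
  unfolding aff_span_def by blast

lemma aff_span_const: "(\<lambda>z. c) \<in> aff_span r F"
  by (rule aff_spanI[where c = "\<lambda>_. 0" and b = c]) simp

lemma aff_span_coord: "j < r \<Longrightarrow> (\<lambda>z. F z j) \<in> aff_span r F"
  by (rule aff_spanI[where c = "\<lambda>i. if i = j then 1 else 0" and b = 0]) (simp add: if_distrib[of "\<lambda>x. x * _"] cong: if_cong)

lemma aff_span_add: "f \<in> aff_span r F \<Longrightarrow> g \<in> aff_span r F \<Longrightarrow> (\<lambda>z. f z + g z) \<in> aff_span r F"
proof -
  assume "f \<in> aff_span r F" "g \<in> aff_span r F"
  then obtain c b c' b' where "\<forall>z. f z = (\<Sum>j<r. c j * F z j) + b" "\<forall>z. g z = (\<Sum>j<r. c' j * F z j) + b'"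
    unfolding aff_span_def by blast
  then show ?thesis
    by (intro aff_spanI[where c = "\<lambda>i. c i + c' i" and b = "b + b'"]) (simp add: algebra_simps sum.distrib)
qed

lemma aff_span_cmult: "f \<in> aff_span r F \<Longrightarrow> (\<lambda>z. k * f z) \<in> aff_span r F"
proof -
  assume "f \<in> aff_span r F"
  then obtain c b where "\<forall>z. f z = (\<Sum>j<r. c j * F z j) + b"
    unfolding aff_span_def by blast
  then show ?thesis
    by (intro aff_spanI[where c = "\<lambda>i. k * c i" and b = "k * b"]) (simp add: algebra_simps sum_distrib_left)
qed

definition last_width :: "nat \<Rightarrow> (nat \<times> (nat \<Rightarrow> nat \<Rightarrow> real) \<times> (nat \<Rightarrow> real)) list \<Rightarrow> nat" where
  "last_width w ls = (if ls = [] then w else fst (last ls))"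

text \<open>\<open>mlp_net\<close> recurses from the input side, whereas the networks below grow at
  the output side.\<close>

lemma mlp_net_snoc:
  "mlp_net w (ls @ [(r, W, b)]) v =
     (\<lambda>i. if i < r then (\<Sum>j<last_width w ls. W i j * max 0 (mlp_net w ls v j)) + b i else 0)"
proof (induction ls arbitrary: w v)
  case Nil
  then show ?case by (simp add: last_width_def relu_def fun_eq_iff)
next
  case (Cons l ls)
  then show ?case by (cases l) (auto simp: last_width_def)
qed

text \<open>Quantifying over all affine read-outs lets consecutive affine layers be fused.\<close>

definition net_fn :: "nat \<Rightarrow> nat \<Rightarrow> ('d::finite pt \<Rightarrow> nat \<Rightarrow> real) \<Rightarrow> bool" where
  "net_fn m r F \<longleftrightarrow> (\<forall>s G. (\<forall>i<s. G i \<in> aff_span r F) \<longrightarrow>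
     (\<exists>w A a ls. last_width w ls = s \<and>
       (\<forall>z. mlp_net w ls (\<lambda>j. if j < w then bmv w m A z j + a j else 0) = (\<lambda>i. if i < s then G i z else 0))))"

lemma sum_lessThan_add: "(\<Sum>j<r + k. f j) = (\<Sum>j<r. f j) + (\<Sum>j<k. f (r + j :: nat))" for f :: "nat \<Rightarrow> real"
  by (induction k) (auto simp: algebra_simps)

text \<open>The starting network: the features are the raw coordinates, and the first affine layer
  alone gives every affine read-out.\<close>

lemma net_fn_coords:
  "\<exists>r (F :: 'd::finite pt \<Rightarrow> nat \<Rightarrow> real). net_fn m r F \<and> (\<forall>j. (\<lambda>z. fst z $ j) \<in> aff_span r F) \<and>
      (\<forall>i<m. (\<lambda>z. snd z i) \<in> aff_span r F)"
proof -
  let ?C = "CARD('d)"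
  \<comment> \<open>Columns of the x block are indexed by the type \<open>'d\<close>, features by
    numbers; \<open>e\<close> translates between them.\<close>
  obtain e where e: "bij_betw e {..<?C} (UNIV :: 'd set)"
    using ex_bij_betw_nat_finite[of "UNIV::'d set"] by (auto simp: lessThan_atLeast0)
  define e' where "e' = the_inv_into {..<?C} e"
  have e': "e' j < ?C" "e (e' j) = j" for j
    using e the_inv_into_into[of e "{..<?C}" j "{..<?C}"] f_the_inv_into_f_bij_betw[OF e, of j]
    by (auto simp: e'_def bij_betw_def)
  have e'e: "e' (e i) = i" if "i < ?C" for i
    using e that by (auto simp: e'_def bij_betw_def the_inv_into_f_f)
  define F :: "'d pt \<Rightarrow> nat \<Rightarrow> real" where "F z i = (if i < ?C then fst z $ e i else snd z (i - ?C))" for z i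
  have "net_fn m (?C + m) F"
    unfolding net_fn_def
  proof (intro allI impI)
    fix s and G :: "nat \<Rightarrow> 'd pt \<Rightarrow> real" assume "\<forall>i<s. G i \<in> aff_span (?C + m) F"
    then obtain c b where G: "\<And>i z. i < s \<Longrightarrow> G i z = (\<Sum>j<?C + m. c i j * F z j) + b i"
      unfolding aff_span_def mem_Collect_eq by metis
    define A where "A = ((\<lambda>i j. c i (e' j)), (\<lambda>i j. c i (?C + j)))"
    have "bmv s m A z i + b i = G i z" if "i < s" for i z
    proof -
      have "(\<Sum>j\<in>UNIV. c i (e' j) * fst z $ j) = (\<Sum>j<?C. c i j * fst z $ e j)"
        unfolding sum.reindex_bij_betw[OF e, of "\<lambda>j. c i (e' j) * fst z $ j", symmetric]
        by (rule sum.cong) (auto simp: e'e)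
      then show ?thesis
        using that by (simp add: G bmv_def A_def sum_lessThan_add F_def)
    qed
    then show "\<exists>w A a ls. last_width w ls = s \<and>
       (\<forall>z. mlp_net w ls (\<lambda>j. if j < w then bmv w m A z j + a j else 0) = (\<lambda>i. if i < s then G i z else 0))"
      by (intro exI[of _ s] exI[of _ A] exI[of _ b] exI[of _ "[]"]) (auto simp: last_width_def)
  qed
  moreover have "(\<lambda>z. fst z $ j) \<in> aff_span (?C + m) F" for j
    using aff_span_coord[of "e' j" "?C + m" F] e'[of j] by (simp add: F_def trans_less_add1)
  moreover have "(\<lambda>z. snd z i) \<in> aff_span (?C + m) F" if "i < m" for i
    using aff_span_coord[of "?C + i" "?C + m" F] that by (simp add: F_def)
  ultimately show ?thesis by blast
qed

text \<open>The features found so far must survive the additional ReLU. They pass through it as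
  pairs max(0, F), max(0, -F), whose difference is F; together with \<open>q\<close> the new layer
  has 2r + 1 units.\<close>

lemma net_fn_add_relu:
  assumes F: "net_fn m r F" and q: "q \<in> aff_span r F"
  shows "\<exists>r' F'. net_fn m r' F' \<and> aff_span r F \<subseteq> aff_span r' F' \<and> (\<lambda>z. max 0 (q z)) \<in> aff_span r' F'"
proof -
  define F' where "F' z i = (if i < r then F z i else max 0 (q z))" for z i
  have "net_fn m (Suc r) F'"
    unfolding net_fn_def
  proof (intro allI impI)
    fix s and G :: "nat \<Rightarrow> 'a pt \<Rightarrow> real" assume "\<forall>i<s. G i \<in> aff_span (Suc r) F'"
    then obtain c b where G: "\<And>i z. i < s \<Longrightarrow> G i z = (\<Sum>j<Suc r. c i j * F' z j) + b i"
      unfolding aff_span_def mem_Collect_eq by metis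
    define H where "H i z = (if i < r then F z i else if i < r + r then -1 * F z (i - r) else q z)" for i z
    have "H i \<in> aff_span r F" for i
      using q by (cases "i < r"; cases "i < r + r")
        (auto simp: H_def[abs_def] intro!: aff_span_coord intro: aff_span_cmult[of _ _ _ "-1", simplified])
    then obtain w A a ls where N: "last_width w ls = Suc (r + r)"
       "\<And>z. mlp_net w ls (\<lambda>j. if j < w then bmv w m A z j + a j else 0) = (\<lambda>i. if i < Suc (r + r) then H i z else 0)"
      using F unfolding net_fn_def by meson
    define W where "W i j = (if j < r then c i j else if j < r + r then - c i (j - r) else c i r)" for i j
    have "(\<Sum>j<Suc (r + r). W i j * max 0 (H j z)) + b i = G i z" if "i < s" for i z
    proof -
      have "(\<Sum>j<Suc (r + r). W i j * max 0 (H j z)) =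
          (\<Sum>j<r. c i j * max 0 (F z j)) + (\<Sum>j<r. - c i j * max 0 (- F z j)) + c i r * max 0 (q z)"
        by (simp add: sum_lessThan_add W_def H_def)
      also have "(\<Sum>j<r. c i j * max 0 (F z j)) + (\<Sum>j<r. - c i j * max 0 (- F z j)) = (\<Sum>j<r. c i j * F z j)"
        unfolding sum.distrib[symmetric] by (rule sum.cong) (auto simp: max_def)
      finally show ?thesis using that by (simp add: G F'_def)
    qed
    then show "\<exists>w A a ls. last_width w ls = s \<and>
       (\<forall>z. mlp_net w ls (\<lambda>j. if j < w then bmv w m A z j + a j else 0) = (\<lambda>i. if i < s then G i z else 0))"
      by (intro exI[of _ w] exI[of _ A] exI[of _ a] exI[of _ "ls @ [(s, W, b)]"])
        (auto simp: last_width_def[of _ "_ @ _"] mlp_net_snoc N fun_eq_iff)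
  qed
  moreover have "aff_span r F \<subseteq> aff_span (Suc r) F'"
  proof
    fix g assume "g \<in> aff_span r F"
    then obtain c b where "\<forall>z. g z = (\<Sum>j<r. c j * F z j) + b" unfolding aff_span_def by blast
    then show "g \<in> aff_span (Suc r) F'"
      by (intro aff_spanI[where c = "\<lambda>i. if i < r then c i else 0" and b = b]) (simp add: F'_def del: split_paired_All)
  qed
  moreover have "(\<lambda>z. max 0 (q z)) \<in> aff_span (Suc r) F'"
    using aff_span_coord[of r "Suc r" F'] by (simp add: F'_def)
  ultimately show ?thesis by blast
qed

text \<open>Only the ReLU constructor costs a layer; sums and multiples stay inside the affine span.
  \<open>r\<close> and \<open>F\<close> are generalised so that the second summand is built on top
  of the network for the first.\<close>

lemma net_fn_add_relu_fn:
  assumes "relu_fn m f" "net_fn m r F" "\<forall>j. (\<lambda>z. fst z $ j) \<in> aff_span r F" 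
    "\<forall>i<m. (\<lambda>z. snd z i) \<in> aff_span r F"
  shows "\<exists>r' F'. net_fn m r' F' \<and> aff_span r F \<subseteq> aff_span r' F' \<and> f \<in> aff_span r' F'"
  using assms
proof (induction arbitrary: r F rule: relu_fn.induct)
  case (relu_fn_add f g)
  obtain r1 F1 where 1: "net_fn m r1 F1" "aff_span r F \<subseteq> aff_span r1 F1" "f \<in> aff_span r1 F1"
    using relu_fn_add by meson
  then obtain r2 F2 where 2: "net_fn m r2 F2" "aff_span r1 F1 \<subseteq> aff_span r2 F2" "g \<in> aff_span r2 F2"
    using relu_fn_add.IH(2)[of r1 F1] relu_fn_add.prems by blast
  then show ?case using 1 aff_span_add by blast
next
  case (relu_fn_cmult f c)
  then show ?case using aff_span_cmult by blast
next
  case (relu_fn_relu f)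
  then obtain r1 F1 where 1: "net_fn m r1 F1" "aff_span r F \<subseteq> aff_span r1 F1" "f \<in> aff_span r1 F1"
    by meson
  then show ?case using net_fn_add_relu[of m r1 F1 f] by blast
qed (use aff_span_const in blast)+

text \<open>All outputs share one feature network, enlarged for one output after another; a single
  affine read-out then delivers all of them.\<close>

lemma mlp_realizes_relu_fn:
  assumes "\<And>i. i < s \<Longrightarrow> relu_fn m (f i)"
  shows "\<exists>\<xi>. mlp m s \<xi> = (\<lambda>z. (fst z, \<lambda>i. if i < s then f i z else 0))"
proof -
  have "\<exists>r F. net_fn m r F \<and> (\<forall>j. (\<lambda>z. fst z $ j) \<in> aff_span r F) \<and>
      (\<forall>i<m. (\<lambda>z. snd z i) \<in> aff_span r F) \<and> (\<forall>i<k. f i \<in> aff_span r F)" if "k \<le> s" for k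
    using that
  proof (induction k)
    case 0
    then show ?case using net_fn_coords[where 'd='a, of m] by auto
  next
    case (Suc k)
    then obtain r F where F: "net_fn m r F" "\<forall>j. (\<lambda>z. fst z $ j) \<in> aff_span r F"
      "\<forall>i<m. (\<lambda>z. snd z i) \<in> aff_span r F" "\<forall>i<k. f i \<in> aff_span r F" by auto
    then obtain r' F' where "net_fn m r' F'" "aff_span r F \<subseteq> aff_span r' F'" "f k \<in> aff_span r' F'"
      using net_fn_add_relu_fn[OF assms, of k] Suc.prems by (metis Suc_le_lessD)
    then show ?case using F by (intro exI[of _ r'] exI[of _ F']) (auto simp: less_Suc_eq)
  qed
  then obtain r F where "net_fn m r F" "\<forall>i<s. f i \<in> aff_span r F" by blast
  then obtain w A a ls where
    "\<And>z. mlp_net w ls (\<lambda>j. if j < w then bmv w m A z j + a j else 0) = (\<lambda>i. if i < s then f i z else 0)"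
    unfolding net_fn_def by meson
  then show ?thesis
    by (intro exI[of _ "(w, A, a, ls)"]) (simp add: mlp_def fun_eq_iff)
qed

subsection \<open>Stacks of uniform attention layers\<close>

text \<open>Lets a stack be extended by changing parameters above layer \<open>l\<close>.
  \<open>din\<close> has to agree up to \<open>Suc l\<close>, because layer \<open>l\<close> writes
  tokens of width \<open>din (Suc l)\<close>.\<close>

lemma tstack_cong:
  assumes "\<And>k. k \<le> Suc l \<Longrightarrow> din k = din' k" "\<And>k. k \<le> l \<Longrightarrow> \<xi> k = \<xi>' k"
  shows "tstack din dmid \<theta> \<xi> l = tstack din' dmid \<theta> \<xi>' l"
  using assms by (induction l) auto

lemma fst_tstack: "fst (tstack din dmid \<theta> \<xi> l \<mu> z) = fst z"
  by (induction l arbitrary: z) (auto simp: ic_comp_def mlp_def attn_def split: prod.splits)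

text \<open>The head reads cell \<open>2 * n + 2\<close> and writes its mean into cell
  \<open>n + 1\<close>. Row \<open>n + 1\<close> of \<open>WLm\<close> is zero, so the mean replaces
  the old content instead of being added to it.\<close>

definition mean_attn :: "nat \<Rightarrow> 'd::finite attn_par" where
  "mean_attn n = \<lparr>nheads = 1, kdim = 1, hdim = 1,
     Qm = (\<lambda>h. (\<lambda>i j. 0, \<lambda>i j. 0)), Km = (\<lambda>h. (\<lambda>i j. 0, \<lambda>i j. 0)),
     Vm = (\<lambda>h. (\<lambda>i j. 0, \<lambda>i j. if j = 2 * n + 2 then 1 else 0)),
     WLm = (\<lambda>i j. 0, \<lambda>i j. if j = i \<and> i \<noteq> n + 1 then 1 else 0),
     Wm = (\<lambda>h i j. if i = n + 1 then 1 else 0)\<rparr>"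

text \<open>All softmax weights are 1, since the constant normaliser integrates to 1. The test
  \<open>2 * n + 2 < m\<close> fails in the first layer, where \<open>m = n\<close> and no scratch
  cell exists yet.\<close>

lemma attn_mean_attn:
  assumes "prob_space \<mu>"
  shows "attn m D (mean_attn n) \<mu> z = (fst z, \<lambda>i. if i < D then
      (if i < m \<and> i \<noteq> n + 1 then snd z i else 0) +
      (if i = n + 1 \<and> 2 * n + 2 < m then \<integral>z'. snd z' (2 * n + 2) \<partial>\<mu> else 0) else 0)"
proof -
  interpret prob_space \<mu> by fact
  have w: "attn_weight m (mean_attn n) h \<mu> z z' = 1" for h z z'
    by (simp add: attn_weight_def mean_attn_def bmv_def ip_def prob_space)
  have V: "bmv 1 m (Vm (mean_attn n) 0) z' 0 = (if 2 * n + 2 < m then snd z' (2 * n + 2) else 0)" for z' :: "'a pt"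
    by (simp add: mean_attn_def bmv_def if_distrib[of "\<lambda>x. x * _"] cong: if_cong)
  have W: "bmv D m (WLm (mean_attn n)) z i = (if i < m \<and> i \<noteq> n + 1 then snd z i else 0)" if "i < D" for i
    using that by (cases "i = n + 1") (simp_all add: mean_attn_def bmv_def if_distrib[of "\<lambda>x. x * _"] cong: if_cong)
  have p: "nheads (mean_attn n :: 'a attn_par) = 1" "hdim (mean_attn n :: 'a attn_par) = 1"
      "Wm (mean_attn n :: 'a attn_par) 0 i 0 = (if i = n + 1 then 1 else 0)" for i
    by (auto simp: mean_attn_def)
  show ?thesis
    unfolding attn_def w p lessThan_Suc_eq_insert_0[of 0, simplified] One_nat_def
    using V by (auto simp: p W fun_eq_iff)
qed

text \<open>The token layout used between layers: \<open>n + 1\<close> accumulators, one cell that receives the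
  context mean, the original \<open>y\<close>, and one scratch cell whose context mean is taken next.\<close>

definition tok :: "nat \<Rightarrow> real^'d::finite \<Rightarrow> (nat \<Rightarrow> real) \<Rightarrow> real \<Rightarrow> (nat \<Rightarrow> real) \<Rightarrow> 'd pt" where
  "tok n x y s A = (x, \<lambda>i. if i \<le> n then A i else if n + 2 \<le> i \<and> i < 2 * n + 2 then y (i - (n + 2))
      else if i = 2 * n + 2 then s else 0)"

definition width :: "'d::finite itself \<Rightarrow> nat \<Rightarrow> nat" where
  "width TYPE('d) n = 4 * CARD('d) + 4 * n"

text \<open>The layout occupies cells 0 to \<open>2 * n + 2\<close>; they fit because d is at least
  1.\<close>

lemma width_ge: "2 * n + 4 \<le> width TYPE('d::finite) n"
proof -
  have "0 < CARD('d)" by (simp add: card_gt_0_iff)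
  then show ?thesis unfolding width_def by linarith
qed

abbreviation mean_stack :: "nat \<Rightarrow> (nat \<Rightarrow> 'd::finite mlp_par) \<Rightarrow> nat \<Rightarrow> 'd pt measure \<Rightarrow> 'd pt \<Rightarrow> 'd pt" where
  "mean_stack n \<equiv> tstack (\<lambda>l. if l = Suc 0 then n else width TYPE('d) n) (\<lambda>l. width TYPE('d) n) (\<lambda>l. mean_attn n)"

text \<open>The invariant of the layerwise construction. The next layer can only average what the
  current one leaves in the scratch cell, so any requested \<open>\<phi>\<close> must be loadable
  there. Depth and parameters are fixed before \<open>\<mu>\<close>; measurability is carried along
  because the next attention layer integrates against the pushforward.\<close>

definition computable :: "nat \<Rightarrow> ('d::finite pt measure \<Rightarrow> real^'d \<Rightarrow> nat \<Rightarrow> real) \<Rightarrow> bool" where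
  "computable n A \<longleftrightarrow> (\<forall>\<phi>. relu_fn n \<phi> \<longrightarrow> (\<exists>l\<ge>1. \<exists>\<xi>. \<forall>\<mu>. prob_space \<mu> \<longrightarrow> sets \<mu> = sets borel \<longrightarrow>
      mean_stack n \<xi> l \<mu> \<in> borel_measurable borel \<and>
      (\<forall>z. mean_stack n \<xi> l \<mu> z = tok n (fst z) (snd z) (\<phi> z) (A \<mu> (fst z)))))"

lemma computable_cong:
  assumes "computable n A" "\<And>\<mu> x i. i \<le> n \<Longrightarrow> A \<mu> x i = A' \<mu> x i"
  shows "computable n A'"
proof -
  have "tok n x y s (A \<mu> x) = tok n x y s (A' \<mu> x)" for x y s \<mu>
    using assms(2) by (auto simp: tok_def)
  then show ?thesis using assms(1) unfolding computable_def by simp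
qed

lemma measurable_token_map:
  assumes "\<And>i. i < m \<Longrightarrow> relu_fn k (g i)"
  shows "(\<lambda>z. (fst z, \<lambda>i. if i < m then g i z else 0)) \<in> borel_measurable borel"
proof -
  have "continuous_on UNIV (\<lambda>z. (fst z, \<lambda>i. if i < m then g i z else 0))"
  proof (intro continuous_intros)
    fix i
    show "continuous_on UNIV (\<lambda>z. if i < m then g i z else 0)"
      using continuous_on_relu_fn[OF assms, of i] by (cases "i < m") auto
  qed
  then show ?thesis by (rule borel_measurable_continuous_onI)
qed

lemma measurable_attn_mean_attn:
  assumes "prob_space \<mu>"
  shows "attn m D (mean_attn n) \<mu> \<in> borel_measurable borel"
proof -
  have "relu_fn D (\<lambda>z. (if i < m \<and> i \<noteq> n + 1 then snd z i else 0) +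
      (if i = n + 1 \<and> 2 * n + 2 < m then \<integral>z'. snd z' (2 * n + 2) \<partial>\<mu> else 0))" if "i < D" for i
  proof (rule relu_fn_add[OF _ relu_fn_const])
    show "relu_fn D (\<lambda>z. if i < m \<and> i \<noteq> n + 1 then snd z i else 0)"
      using relu_fn_snd[OF that] relu_fn_const[of D 0] by (cases "i < m \<and> i \<noteq> n + 1") (simp_all only: simp_thms if_True if_False)
  qed
  from measurable_token_map[OF this] show ?thesis
    unfolding attn_mean_attn[OF assms, abs_def] .
qed

lemma mean_stack_Suc:
  assumes \<mu>: "prob_space \<mu>" "sets \<mu> = sets borel"
    and meas: "mean_stack n \<xi> l \<mu> \<in> borel_measurable borel"
    and net: "mlp (width TYPE('d::finite) n) (width TYPE('d) n) (\<xi> (Suc l)) =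
      (\<lambda>z :: 'd pt. (fst z, \<lambda>i. if i < width TYPE('d) n then g i z else 0))"
    and g: "\<And>i. i < width TYPE('d) n \<Longrightarrow> relu_fn k (g i)"
  shows "mean_stack n \<xi> (Suc l) \<mu> \<in> borel_measurable borel"
    and "attn (if l = 0 then n else width TYPE('d) n) (width TYPE('d) n) (mean_attn n)
         (distr \<mu> borel (mean_stack n \<xi> l \<mu>)) (mean_stack n \<xi> l \<mu> z) = w \<Longrightarrow>
       mean_stack n \<xi> (Suc l) \<mu> z = (fst w, \<lambda>i. if i < width TYPE('d) n then g i w else 0)"
proof -
  let ?D = "width TYPE('d) n"
  have m: "mean_stack n \<xi> l \<mu> \<in> measurable \<mu> borel"
    using meas \<mu>(2) by (simp cong: measurable_cong_sets)
  have p: "prob_space (distr \<mu> borel (mean_stack n \<xi> l \<mu>))"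
    by (rule prob_space.prob_space_distr[OF \<mu>(1) m])
  have eq: "mean_stack n \<xi> (Suc l) \<mu> z = (\<lambda>z. (fst z, \<lambda>i. if i < ?D then g i z else 0))
       (attn (if l = 0 then n else ?D) ?D (mean_attn n)
         (distr \<mu> borel (mean_stack n \<xi> l \<mu>)) (mean_stack n \<xi> l \<mu> z))" for z
    by (simp add: ic_comp_def net)
  show "attn (if l = 0 then n else ?D) ?D (mean_attn n)
         (distr \<mu> borel (mean_stack n \<xi> l \<mu>)) (mean_stack n \<xi> l \<mu> z) = w \<Longrightarrow>
       mean_stack n \<xi> (Suc l) \<mu> z = (fst w, \<lambda>i. if i < ?D then g i w else 0)"
    unfolding eq by blast
  show "mean_stack n \<xi> (Suc l) \<mu> \<in> borel_measurable borel"
    unfolding eq[abs_def]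
    by (intro measurable_compose[OF _ measurable_token_map[of ?D k g, OF g]]
        measurable_compose[OF meas measurable_attn_mean_attn[OF p]])
qed

text \<open>One layer suffices: attention hands on the n input coordinates, and the MLP unpacks them
  into the layout, moving y to the cells from \<open>n + 2\<close> on and loading
  \<open>\<phi>\<close>.\<close>

lemma computable_const: "computable n (\<lambda>(\<mu> :: 'd::finite pt measure) x i. c)"
  unfolding computable_def
proof (intro allI impI)
  fix \<phi> :: "'d pt \<Rightarrow> real" assume \<phi>: "relu_fn n \<phi>"
  let ?D = "width TYPE('d) n"
  define g :: "nat \<Rightarrow> 'd pt \<Rightarrow> real" where "g i = (if i \<le> n then (\<lambda>z. c)
      else if n + 2 \<le> i \<and> i < 2 * n + 2 then (\<lambda>z. snd z (i - (n + 2)))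
      else if i = 2 * n + 2 then \<phi> else (\<lambda>z. 0))" for i
  have g: "relu_fn ?D (g i)" for i
    using width_ge[where 'd='d, of n] by (auto simp: g_def intro!: relu_fn_intros relu_fn_mono[OF \<phi>])
  then obtain \<xi> where \<xi>: "mlp ?D ?D \<xi> = (\<lambda>z. (fst z, \<lambda>i. if i < ?D then g i z else 0))"
    using mlp_realizes_relu_fn by blast
  have "mean_stack n (\<lambda>_. \<xi>) 1 \<mu> \<in> borel_measurable borel \<and>
      mean_stack n (\<lambda>_. \<xi>) 1 \<mu> z = tok n (fst z) (snd z) (\<phi> z) (\<lambda>_. c)"
    if \<mu>: "prob_space \<mu>" "sets \<mu> = sets borel" for \<mu> z
  proof -
    have d: "distr \<mu> borel (\<lambda>z. z) = \<mu>"
      by (rule distr_id2[OF \<mu>(2)[symmetric]])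
    have *: "attn n ?D (mean_attn n) \<mu> z = (fst z, \<lambda>i. if i < n then snd z i else 0)"
    proof -
      have "(if i < ?D then (if i < n \<and> i \<noteq> n + 1 then snd z i else 0) +
        (if i = n + 1 \<and> 2 * n + 2 < n then \<integral>z'. snd z' (2 * n + 2) \<partial>\<mu> else 0) else 0) =
        (if i < n then snd z i else 0)" for i
        using width_ge[where 'd='d, of n] by auto
      then show ?thesis unfolding attn_mean_attn[OF \<mu>(1)] by presburger
    qed
    \<comment> \<open>The first layer cuts off the cells from n on; \<open>\<phi>\<close> does not
      read them.\<close>
    have "\<phi> (fst z, \<lambda>i. if i < n then snd z i else 0) = \<phi> z"
      by (rule relu_fn_cong[OF \<phi>]) auto
    then have "(\<lambda>z. (fst z, \<lambda>i. if i < ?D then g i z else 0)) (fst z, \<lambda>i. if i < n then snd z i else 0)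
        = tok n (fst z) (snd z) (\<phi> z) (\<lambda>_. c)"
      using width_ge[where 'd='d, of n] by (auto simp: g_def tok_def fun_eq_iff)
    moreover have "mean_stack n (\<lambda>_. \<xi>) 0 \<mu> \<in> borel_measurable borel" by simp
    note S = mean_stack_Suc[of \<mu> n "\<lambda>_. \<xi>" 0 g ?D, OF \<mu> this \<xi> g]
    moreover have "attn (if 0 = 0 then n else ?D) ?D (mean_attn n)
         (distr \<mu> borel (mean_stack n (\<lambda>_. \<xi>) 0 \<mu>)) (mean_stack n (\<lambda>_. \<xi>) 0 \<mu> z) =
         (fst z, \<lambda>i. if i < n then snd z i else 0)"
      by (simp add: d *)
    note S(2)[OF this]
    ultimately show ?thesis
      using S(1) by (simp del: tstack.simps)
  qed
  then show "\<exists>l\<ge>1. \<exists>\<xi>. \<forall>\<mu>. prob_space \<mu> \<longrightarrow> sets \<mu> = sets borel \<longrightarrow>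
      mean_stack n \<xi> l \<mu> \<in> borel_measurable borel \<and>
      (\<forall>z. mean_stack n \<xi> l \<mu> z = tok n (fst z) (snd z) (\<phi> z) (\<lambda>i. c))"
    by (intro exI[of _ 1] conjI exI[of _ "\<lambda>_. \<xi>"] allI impI) (simp_all del: tstack.simps One_nat_def)
qed

text \<open>Change of variables: the scratch cell stores \<open>\<phi>\<close> of the original
  token, so its mean over the transformed context is the integral of \<open>\<phi>\<close> against
  the original \<open>\<mu>\<close>.\<close>

lemma attn_tok:
  assumes \<mu>: "prob_space \<mu>" and T: "T \<in> measurable \<mu> borel" and s: "\<And>z. snd (T z) (2 * n + 2) = \<phi> z"
  shows "attn (width TYPE('d) n) (width TYPE('d::finite) n) (mean_attn n) (distr \<mu> borel T) (tok n x y s A) =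
    (x, \<lambda>i. if i = n + 1 then \<integral>z. \<phi> z \<partial>\<mu> else snd (tok n x y s A :: 'd pt) i)"
proof -
  have "(\<lambda>z :: 'd pt. snd z (2 * n + 2)) \<in> borel_measurable borel"
    by (rule borel_measurable_relu_fn[OF relu_fn_snd[OF lessI]])
  then have "(\<integral>z. snd z (2 * n + 2) \<partial>distr \<mu> borel T) = (\<integral>z. \<phi> z \<partial>\<mu>)"
    using integral_distr[OF T, of "\<lambda>z. snd z (2 * n + 2)"] unfolding s by blast
  then show ?thesis
    using width_ge[where 'd='d, of n]
    by (auto simp: attn_mean_attn[OF prob_space.prob_space_distr[OF \<mu> T]] tok_def fun_eq_iff)
qed

text \<open>One more layer: attention delivers the mean of \<open>\<phi>\<close>, the MLP updates
  the accumulators by \<open>g\<close> and loads the statistic \<open>\<psi>\<close> requested next.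
  \<open>g\<close> reads x, the \<open>n + 1\<close> accumulators and the mean in cell
  \<open>n + 1\<close>, hence \<open>n + 2\<close> cells.\<close>

lemma computable_step:
  fixes A :: "'d::finite pt measure \<Rightarrow> real^'d \<Rightarrow> nat \<Rightarrow> real"
  assumes A: "computable n A" and \<phi>: "relu_fn n \<phi>" and g: "\<And>i. i \<le> n \<Longrightarrow> relu_fn (n + 2) (g i)"
  shows "computable n (\<lambda>\<mu> x i. g i (x, \<lambda>j. if j \<le> n then A \<mu> x j else \<integral>z. \<phi> z \<partial>\<mu>))"
  unfolding computable_def
proof (intro allI impI)
  fix \<psi> :: "'d pt \<Rightarrow> real" assume \<psi>: "relu_fn n \<psi>"
  let ?D = "width TYPE('d) n"
  obtain l \<xi> where l: "l \<ge> 1" and \<xi>: "\<And>\<mu>. prob_space \<mu> \<Longrightarrow> sets \<mu> = sets borel \<Longrightarrow> mean_stack n \<xi> l \<mu> \<in> borel_measurable borel"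
    "\<And>\<mu> z. prob_space \<mu> \<Longrightarrow> sets \<mu> = sets borel \<Longrightarrow> mean_stack n \<xi> l \<mu> z = tok n (fst z) (snd z) (\<phi> z) (A \<mu> (fst z))"
    using A \<phi> unfolding computable_def by metis
  define h :: "nat \<Rightarrow> 'd pt \<Rightarrow> real" where "h i = (if i \<le> n then g i
      else if n + 2 \<le> i \<and> i < 2 * n + 2 then (\<lambda>z. snd z i)
      else if i = 2 * n + 2 then (\<lambda>z. \<psi> (fst z, \<lambda>j. snd z ((n + 2) + j))) else (\<lambda>z. 0))" for i
  have h: "relu_fn ?D (h i)" for i
    using width_ge[where 'd='d, of n]
    by (auto simp: h_def intro!: relu_fn_intros relu_fn_mono[OF g] relu_fn_shift[OF \<psi>] simp del: add_2_eq_Suc')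
  then obtain \<zeta> where \<zeta>: "mlp ?D ?D \<zeta> = (\<lambda>z. (fst z, \<lambda>i. if i < ?D then h i z else 0))"
    using mlp_realizes_relu_fn by blast
  define \<xi>' where "\<xi>' = \<xi>(Suc l := \<zeta>)"
  have eq: "mean_stack n \<xi>' l = mean_stack n \<xi> l"
    by (rule tstack_cong) (auto simp: \<xi>'_def)
  have "mean_stack n \<xi>' (Suc l) \<mu> \<in> borel_measurable borel \<and>
      mean_stack n \<xi>' (Suc l) \<mu> z = tok n (fst z) (snd z) (\<psi> z)
        (\<lambda>i. g i (fst z, \<lambda>j. if j \<le> n then A \<mu> (fst z) j else \<integral>z. \<phi> z \<partial>\<mu>))"
    if \<mu>: "prob_space \<mu>" "sets \<mu> = sets borel" for \<mu> z
  proof -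
    let ?w = "(fst z, \<lambda>i. if i = n + 1 then \<integral>z. \<phi> z \<partial>\<mu> else snd (tok n (fst z) (snd z) (\<phi> z) (A \<mu> (fst z)) :: 'd pt) i)"
    have m: "mean_stack n \<xi> l \<mu> \<in> measurable \<mu> borel"
      using \<xi>(1)[OF \<mu>] \<mu>(2) by (simp cong: measurable_cong_sets)
    have *: "attn (if l = 0 then n else ?D) ?D (mean_attn n) (distr \<mu> borel (mean_stack n \<xi>' l \<mu>)) (mean_stack n \<xi>' l \<mu> z) = ?w"
      using attn_tok[OF \<mu>(1) m, where n = n and \<phi> = \<phi> and x = "fst z" and y = "snd z" and s = "\<phi> z" and A = "A \<mu> (fst z)"] l
      by (simp add: eq \<xi>(2)[OF \<mu>] tok_def)
    have 1: "\<psi> (fst ?w, \<lambda>j. snd ?w ((n + 2) + j)) = \<psi> z"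
      by (rule relu_fn_cong[OF \<psi>]) (auto simp: tok_def)
    have 2: "g i ?w = g i (fst z, \<lambda>j. if j \<le> n then A \<mu> (fst z) j else \<integral>z. \<phi> z \<partial>\<mu>)" if "i \<le> n" for i
      by (rule relu_fn_cong[OF g[OF that]]) (auto simp: tok_def)
    have "(\<lambda>z. (fst z, \<lambda>i. if i < ?D then h i z else 0)) ?w = tok n (fst z) (snd z) (\<psi> z)
        (\<lambda>i. g i (fst z, \<lambda>j. if j \<le> n then A \<mu> (fst z) j else \<integral>z. \<phi> z \<partial>\<mu>))"
    proof -
      have "(if i < ?D then h i ?w else 0) = snd (tok n (fst z) (snd z) (\<psi> z)
        (\<lambda>i. g i (fst z, \<lambda>j. if j \<le> n then A \<mu> (fst z) j else \<integral>z. \<phi> z \<partial>\<mu>)) :: 'd pt) i" for i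
      proof (cases "i \<le> n \<or> i = 2 * n + 2")
        case True
        then show ?thesis using 1 2[of i] width_ge[where 'd='d, of n] unfolding h_def tok_def by auto
      next
        case False
        then show ?thesis using width_ge[where 'd='d, of n] unfolding h_def tok_def by auto
      qed
      then show ?thesis by (auto simp: tok_def)
    qed
    moreover have "mean_stack n \<xi>' l \<mu> \<in> borel_measurable borel"
      unfolding eq by (rule \<xi>(1)[OF \<mu>])
    moreover have "mlp ?D ?D (\<xi>' (Suc l)) = (\<lambda>z. (fst z, \<lambda>i. if i < ?D then h i z else 0))"
      by (simp add: \<xi>'_def \<zeta>)
    ultimately show ?thesis
      using mean_stack_Suc(1)[OF \<mu> _ _ h, of n \<xi>' l] mean_stack_Suc(2)[OF \<mu> _ _ h *]
      by (simp del: tstack.simps)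
  qed
  then show "\<exists>l\<ge>1. \<exists>\<xi>. \<forall>\<mu>. prob_space \<mu> \<longrightarrow> sets \<mu> = sets borel \<longrightarrow>
      mean_stack n \<xi> l \<mu> \<in> borel_measurable borel \<and>
      (\<forall>z. mean_stack n \<xi> l \<mu> z = tok n (fst z) (snd z) (\<psi> z)
         (\<lambda>i. g i (fst z, \<lambda>j. if j \<le> n then A \<mu> (fst z) j else \<integral>z. \<phi> z \<partial>\<mu>)))"
    by (intro exI[of _ "Suc l"] conjI exI[of _ \<xi>'] allI impI) (simp_all del: tstack.simps One_nat_def)
qed

text \<open>A final layer drops everything but accumulators 0 to n - 1; accumulator \<open>n\<close>
  is working space and does not reach the output.\<close>

lemma computable_realized:
  fixes A :: "'d::finite pt measure \<Rightarrow> real^'d \<Rightarrow> nat \<Rightarrow> real"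
  assumes A: "computable n A"
  shows "\<exists>J>0. \<exists>\<theta> \<xi>. \<forall>\<mu>. prob_space \<mu> \<longrightarrow> sets \<mu> = sets borel \<longrightarrow>
    (let T = tstack (\<lambda>l. if l = 1 \<or> l = J + 1 then n else 4 * CARD('d) + 4 * n) (\<lambda>l. 4 * CARD('d) + 4 * n) \<theta> \<xi> J \<mu>
     in T \<in> borel_measurable borel \<and> (\<forall>z. T z = (fst z, \<lambda>i. if i < n then A \<mu> (fst z) i else 0)))"
proof -
  let ?D = "width TYPE('d) n"
  obtain l \<xi> where l: "l \<ge> 1" and \<xi>: "\<And>\<mu>. prob_space \<mu> \<Longrightarrow> sets \<mu> = sets borel \<Longrightarrow> mean_stack n \<xi> l \<mu> \<in> borel_measurable borel"
    "\<And>\<mu> z. prob_space \<mu> \<Longrightarrow> sets \<mu> = sets borel \<Longrightarrow> mean_stack n \<xi> l \<mu> z = tok n (fst z) (snd z) 0 (A \<mu> (fst z))"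
    using A relu_fn_const[of n 0] unfolding computable_def by metis
  have g: "relu_fn ?D (\<lambda>z :: 'd pt. snd z i)" if "i < n" for i
    using that width_ge[where 'd='d, of n] by (intro relu_fn_snd) linarith
  then obtain \<zeta> where \<zeta>: "mlp ?D n \<zeta> = (\<lambda>z :: 'd pt. (fst z, \<lambda>i. if i < n then snd z i else 0))"
    using mlp_realizes_relu_fn[of n ?D "\<lambda>i z. snd z i"] by blast
  define \<xi>' where "\<xi>' = \<xi>(Suc l := \<zeta>)"
  define din where "din = (\<lambda>k. if k = 1 \<or> k = Suc l + 1 then n else ?D)"
  define dmid where "dmid = (\<lambda>k::nat. ?D)"
  have eq: "tstack din dmid (\<lambda>_. mean_attn n) \<xi>' l = mean_stack n \<xi> l"
    unfolding dmid_def by (rule tstack_cong) (auto simp: \<xi>'_def din_def)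
  have "tstack din dmid (\<lambda>_. mean_attn n) \<xi>' (Suc l) \<mu> \<in> borel_measurable borel \<and>
    tstack din dmid (\<lambda>_. mean_attn n) \<xi>' (Suc l) \<mu> z = (fst z, \<lambda>i. if i < n then A \<mu> (fst z) i else 0)"
    if \<mu>: "prob_space \<mu>" "sets \<mu> = sets borel" for \<mu> z
  proof -
    have m: "mean_stack n \<xi> l \<mu> \<in> measurable \<mu> borel"
      using \<xi>(1)[OF \<mu>] \<mu>(2) by (simp cong: measurable_cong_sets)
    have s: "tstack din dmid (\<lambda>_. mean_attn n) \<xi>' (Suc l) \<mu> z =
       (\<lambda>z. (fst z, \<lambda>i. if i < n then snd z i else 0))
       (attn ?D ?D (mean_attn n) (distr \<mu> borel (mean_stack n \<xi> l \<mu>)) (mean_stack n \<xi> l \<mu> z))" for z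
      \<comment> \<open>\<open>l \<ge> 1\<close> makes layer \<open>Suc l\<close> different from the
        first one, so its input width is \<open>?D\<close> and not \<open>n\<close>.\<close>
      using l eq by (simp add: ic_comp_def \<zeta> dmid_def) (simp add: din_def \<xi>'_def \<zeta>)
    have "tstack din dmid (\<lambda>_. mean_attn n) \<xi>' (Suc l) \<mu> \<in> borel_measurable borel"
      unfolding s[abs_def]
      by (intro measurable_compose[OF _ measurable_token_map[OF g]]
          measurable_compose[OF \<xi>(1)[OF \<mu>] measurable_attn_mean_attn[OF prob_space.prob_space_distr[OF \<mu>(1) m]]])
    moreover have "attn ?D ?D (mean_attn n) (distr \<mu> borel (mean_stack n \<xi> l \<mu>)) (mean_stack n \<xi> l \<mu> z) =
        (fst z, \<lambda>i. if i = n + 1 then \<integral>z. 0 \<partial>\<mu> else snd (tok n (fst z) (snd z) 0 (A \<mu> (fst z)) :: 'd pt) i)"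
      unfolding \<xi>(2)[OF \<mu>, of z] by (rule attn_tok[OF \<mu>(1) m]) (simp add: \<xi>(2)[OF \<mu>] tok_def)
    ultimately show ?thesis
      unfolding s by (auto simp: tok_def fun_eq_iff)
  qed
  then show ?thesis
    unfolding Let_def width_def[symmetric] din_def dmid_def
    by (intro exI[of _ "Suc l"] conjI exI[of _ "\<lambda>_. mean_attn n"] exI[of _ \<xi>'] allI impI) (simp_all del: tstack.simps One_nat_def)
qed

section \<open>Accumulating distances and maxima across layers\<close>

text \<open>Accumulator \<open>n\<close> is a register for \<rho>: it is reset to the part
  \<open>c x\<close> that depends on x and then gains one absolute value per layer, while the other
  accumulators rest. The reset is itself a step, whose incoming mean is that of the zero
  function.\<close>

lemma computable_stat_distance:
  fixes A :: "'d::finite pt measure \<Rightarrow> real^'d \<Rightarrow> nat \<Rightarrow> real" and N :: nat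
  assumes A: "computable n A" and \<phi>: "\<And>k. k < N \<Longrightarrow> relu_fn n (\<phi> k)"
    and c: "relu_fn (n + 2) (\<lambda>z. c (fst z))"
  shows "computable n (\<lambda>\<mu> x i. if i = n then c x + (\<Sum>k<N. \<bar>(\<integral>z. \<phi> k z \<partial>\<mu>) - a k\<bar>) else A \<mu> x i)"
  using \<phi>
proof (induction N)
  case 0
  let ?g = "\<lambda>i. if i = n then \<lambda>z. c (fst z) else (\<lambda>z :: 'd pt. snd z i)"
  have "relu_fn (n + 2) (?g i)" if "i \<le> n" for i
    using c that by (auto intro: relu_fn_snd)
  from computable_step[where g = ?g, OF A relu_fn_const[of n 0] this]
  show ?case by (rule computable_cong) auto
next
  case (Suc N)
  let ?g = "\<lambda>i. if i = n then (\<lambda>z. snd z n + \<bar>snd z (n + 1) - a N\<bar>) else (\<lambda>z :: 'd pt. snd z i)"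
  have "relu_fn (n + 2) (?g i)" if "i \<le> n" for i
    using that by (auto intro!: relu_fn_snd relu_fn_add relu_fn_abs relu_fn_diff relu_fn_const)
  moreover have "computable n (\<lambda>\<mu> x i. if i = n then c x + (\<Sum>k<N. \<bar>(\<integral>z. \<phi> k z \<partial>\<mu>) - a k\<bar>) else A \<mu> x i)"
    using Suc by simp
  ultimately have "computable n (\<lambda>\<mu> x i. ?g i (x, \<lambda>j. if j \<le> n then
      if j = n then c x + (\<Sum>k<N. \<bar>(\<integral>z. \<phi> k z \<partial>\<mu>) - a k\<bar>) else A \<mu> x j else \<integral>z. \<phi> N z \<partial>\<mu>))"
    using Suc.prems[OF lessI] by (intro computable_step[where g = ?g])
  then show ?case by (rule computable_cong) auto
qed

text \<open>Accumulators 0 to n - 1 hold running maxima for the n components, which all use the same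
  distance register. A further point of \<open>P\<close> costs N + 2 layers: one reset, N
  statistics, one update of the maxima. \<open>b\<close> is the initial value and keeps the set
  nonempty.\<close>

lemma computable_Max:
  fixes q :: "'p \<Rightarrow> real^'d::finite" and N :: nat
  assumes "finite P" and \<phi>: "\<And>k. k < N \<Longrightarrow> relu_fn n (\<phi> k)"
  shows "\<exists>A. computable n A \<and> (\<forall>\<mu> x. \<forall>i<n. A \<mu> x i =
    Max (insert b ((\<lambda>p. v p i - K * ((\<Sum>j\<in>UNIV. \<bar>x $ j - q p $ j\<bar>) + (\<Sum>k<N. \<bar>(\<integral>z. \<phi> k z \<partial>\<mu>) - a p k\<bar>))) ` P)))"
  using assms(1)
proof induction
  case empty
  show ?case using computable_const[of n b] by (intro exI[of _ "\<lambda>_ _ _. b"]) auto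
next
  case (insert p P)
  then obtain A where A: "computable n A" "\<And>\<mu> x i. i < n \<Longrightarrow> A \<mu> x i =
    Max (insert b ((\<lambda>p. v p i - K * ((\<Sum>j\<in>UNIV. \<bar>x $ j - q p $ j\<bar>) + (\<Sum>k<N. \<bar>(\<integral>z. \<phi> k z \<partial>\<mu>) - a p k\<bar>))) ` P))"
    by blast
  define c where "c x = (\<Sum>j\<in>UNIV. \<bar>x $ j - q p $ j\<bar>)" for x
  have c: "relu_fn (n + 2) (\<lambda>z. c (fst z))"
    unfolding c_def by (intro relu_fn_intros)
  let ?g = "\<lambda>i. if i < n then (\<lambda>z. max (v p i - K * snd z n) (snd z i)) else (\<lambda>z :: 'd pt. 0)"
  have "relu_fn (n + 2) (?g i)" if "i \<le> n" for i
    using that by (auto intro!: relu_fn_snd relu_fn_max relu_fn_cmult relu_fn_diff relu_fn_const)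
  note step = computable_step[where g = ?g, OF computable_stat_distance[where a = "a p", OF A(1) \<phi> c] relu_fn_const[of n 0] this]
  show ?case
    by (rule exI, rule conjI, rule step) (use insert(1) in \<open>auto simp: A(2) c_def insert_commute[of b]\<close>)
qed

subsection \<open>Wasserstein distance and cell masses\<close>

text \<open>With cell masses \<open>s\<close> and \<open>t\<close>, this is the mixture, with
  weights \<open>min (s k) (t k)\<close>, of products of the two laws conditioned on cell k, whose
  densities are \<open>\<phi> k / s k\<close> and \<open>\<phi> k / t k\<close>.\<close>

definition overlap_density :: "nat \<Rightarrow> (nat \<Rightarrow> real) \<Rightarrow> (nat \<Rightarrow> real) \<Rightarrow> (nat \<Rightarrow> 'a \<Rightarrow> real) \<Rightarrow> 'a \<Rightarrow> 'a \<Rightarrow> real" where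
  "overlap_density N s t \<phi> z z' = (\<Sum>k<N. min (s k) (t k) / (s k * t k) * (\<phi> k z * \<phi> k z'))"

text \<open>The density of what remains of the first measure once mass
  \<open>min (s k) (t k)\<close> has been taken out of each cell proportionally.\<close>

definition excess :: "nat \<Rightarrow> (nat \<Rightarrow> real) \<Rightarrow> (nat \<Rightarrow> real) \<Rightarrow> (nat \<Rightarrow> 'a \<Rightarrow> real) \<Rightarrow> 'a \<Rightarrow> real" where
  "excess N s t \<phi> z = (\<Sum>k<N. (1 - min (s k) (t k) / s k) * \<phi> k z)"

text \<open>The density, with respect to the product measure, of the coupling that keeps the common
  mass of each cell inside the cell and transports the excess mass independently.  Cells of mass
  zero are harmless because \<open>x / 0 = 0\<close>.\<close>

definition coupling_density :: "nat \<Rightarrow> (nat \<Rightarrow> real) \<Rightarrow> (nat \<Rightarrow> real) \<Rightarrow> (nat \<Rightarrow> 'a \<Rightarrow> real) \<Rightarrow> 'a \<Rightarrow> 'a \<Rightarrow> real" where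
  "coupling_density N s t \<phi> z z' = overlap_density N s t \<phi> z z' +
     excess N s t \<phi> z * excess N t s \<phi> z' / (1 - (\<Sum>k<N. min (s k) (t k)))"

lemma coupling_density_commute: "coupling_density N s t \<phi> z z' = coupling_density N t s \<phi> z' z"
  unfolding coupling_density_def overlap_density_def by (simp add: mult_ac min.commute)

text \<open>The sums equal 1 only almost everywhere, because the partition of unity is one on X
  only. A locale, so that it can also be used with the two measures exchanged.\<close>

locale partition_pair = M: prob_space M + N: prob_space N for M N :: "'a measure" +
  fixes K :: nat and \<phi> :: "nat \<Rightarrow> 'a \<Rightarrow> real"
  assumes measM [measurable]: "\<And>k. \<phi> k \<in> borel_measurable M"
    and measN [measurable]: "\<And>k. \<phi> k \<in> borel_measurable N"
    and nonneg: "\<And>k z. 0 \<le> \<phi> k z" and le_1: "\<And>k z. \<phi> k z \<le> 1"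
    and sumM: "AE z in M. (\<Sum>k<K. \<phi> k z) = 1"
    and sumN: "AE z in N. (\<Sum>k<K. \<phi> k z) = 1"
begin

definition s :: "nat \<Rightarrow> real" where "s k = (\<integral>z. \<phi> k z \<partial>M)"
definition t :: "nat \<Rightarrow> real" where "t k = (\<integral>z. \<phi> k z \<partial>N)"
definition R :: real where "R = 1 - (\<Sum>k<K. min (s k) (t k))"

lemma integrableM [simp, intro]: "integrable M (\<phi> k)"
  by (rule M.integrable_const_bound[of _ 1]) (auto simp: nonneg le_1)

lemma integrableN [simp, intro]: "integrable N (\<phi> k)"
  by (rule N.integrable_const_bound[of _ 1]) (auto simp: nonneg le_1)

lemma s_nonneg: "0 \<le> s k" unfolding s_def by (simp add: nonneg)
lemma t_nonneg: "0 \<le> t k" unfolding t_def by (simp add: nonneg)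

lemma sum_s: "(\<Sum>k<K. s k) = 1"
proof -
  have "(\<Sum>k<K. s k) = (\<integral>z. (\<Sum>k<K. \<phi> k z) \<partial>M)"
    unfolding s_def by (simp add: Bochner_Integration.integral_sum)
  also have "\<dots> = (\<integral>z. 1 \<partial>M)" by (rule integral_cong_AE) (use sumM in auto)
  finally show ?thesis by (simp add: M.prob_space)
qed

lemma sum_t: "(\<Sum>k<K. t k) = 1"
proof -
  have "(\<Sum>k<K. t k) = (\<integral>z. (\<Sum>k<K. \<phi> k z) \<partial>N)"
    unfolding t_def by (simp add: Bochner_Integration.integral_sum)
  also have "\<dots> = (\<integral>z. 1 \<partial>N)" by (rule integral_cong_AE) (use sumN in auto)
  finally show ?thesis by (simp add: N.prob_space)
qed

lemma R_nonneg: "0 \<le> R"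
proof -
  have "(\<Sum>k<K. min (s k) (t k)) \<le> (\<Sum>k<K. s k)" by (rule sum_mono) simp
  then show ?thesis by (simp add: R_def sum_s)
qed

lemma excess_nonneg: "(\<And>k. 0 \<le> a k) \<Longrightarrow> (\<And>k. 0 \<le> b k) \<Longrightarrow> 0 \<le> excess K a b \<phi> z"
  unfolding excess_def
  by (intro sum_nonneg mult_nonneg_nonneg nonneg) (auto simp: divide_le_eq_1 order_less_le)

lemma overlap_density_nonneg: "0 \<le> overlap_density K s t \<phi> z z'"
  unfolding overlap_density_def
  by (intro sum_nonneg mult_nonneg_nonneg nonneg divide_nonneg_nonneg) (auto simp: s_nonneg t_nonneg)

lemma integral_excess_M: "(\<integral>z. excess K s t \<phi> z \<partial>M) = R"
proof -
  have "(\<integral>z. excess K s t \<phi> z \<partial>M) = (\<Sum>k<K. (1 - min (s k) (t k) / s k) * s k)"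
    unfolding excess_def by (subst Bochner_Integration.integral_sum) (auto simp: s_def)
  also have "\<dots> = (\<Sum>k<K. s k - min (s k) (t k))"
    \<comment> \<open>For \<open>s k = 0\<close> both sides vanish: \<open>t k\<close> is
      nonnegative, so the minimum is 0 as well.\<close>
    by (rule sum.cong) (auto simp: left_diff_distrib min_def t_nonneg dest: antisym[OF _ t_nonneg])
  finally show ?thesis by (simp add: sum_subtractf R_def sum_s)
qed

lemma integral_excess_N: "(\<integral>z. excess K t s \<phi> z \<partial>N) = R"
proof -
  have "(\<integral>z. excess K t s \<phi> z \<partial>N) = (\<Sum>k<K. (1 - min (t k) (s k) / t k) * t k)"
    unfolding excess_def by (subst Bochner_Integration.integral_sum) (auto simp: t_def)
  also have "\<dots> = (\<Sum>k<K. t k - min (s k) (t k))"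
    by (rule sum.cong) (auto simp: left_diff_distrib min_def s_nonneg dest: antisym[OF _ s_nonneg])
  finally show ?thesis by (simp add: sum_subtractf R_def sum_t)
qed

lemma integrable_excess: "integrable M (excess K a b \<phi>)" "integrable N (excess K a b \<phi>)"
  unfolding excess_def[abs_def] by auto

lemma integrable_overlap_density: "integrable N (overlap_density K s t \<phi> z)"
  unfolding overlap_density_def[abs_def] by auto

lemma integral_overlap_density:
  "(\<integral>z'. overlap_density K s t \<phi> z z' \<partial>N) = (\<Sum>k<K. min (s k) (t k) / s k * \<phi> k z)"
proof -
  have "(\<integral>z'. overlap_density K s t \<phi> z z' \<partial>N) = (\<Sum>k<K. min (s k) (t k) / (s k * t k) * (\<phi> k z * t k))"
    unfolding overlap_density_def by (subst Bochner_Integration.integral_sum) (auto simp: t_def)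
  also have "\<dots> = (\<Sum>k<K. min (s k) (t k) / s k * \<phi> k z)"
    by (rule sum.cong) (auto simp: min_def s_nonneg dest: antisym[OF _ s_nonneg])
  finally show ?thesis .
qed

lemma R_le: "R \<le> (\<Sum>k<K. \<bar>s k - t k\<bar>)"
proof -
  have "R = (\<Sum>k<K. s k - min (s k) (t k))" by (simp add: sum_subtractf R_def sum_s)
  also have "\<dots> \<le> (\<Sum>k<K. \<bar>s k - t k\<bar>)" by (rule sum_mono) auto
  finally show ?thesis .
qed

text \<open>For \<open>R = 0\<close> the quotient \<open>R / R\<close> is 0, not 1; but then the
  excess has integral 0 and vanishes almost everywhere.\<close>

lemma AE_excess: "AE z in M. excess K s t \<phi> z * (R / R) = excess K s t \<phi> z"
proof (cases "R = 0")
  case True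
  then have "AE z in M. excess K s t \<phi> z = 0"
    using integral_nonneg_eq_0_iff_AE[OF integrable_excess(1), of s t] integral_excess_M excess_nonneg s_nonneg t_nonneg
    by auto
  then show ?thesis by eventually_elim simp
qed auto

text \<open>Used twice: with weights 1 and 1 it yields a marginal of the coupling, with weights
  \<open>\<eta>\<close> and \<open>B\<close> a bound for its transport cost.\<close>

lemma nn_integral_mix:
  assumes "0 \<le> \<alpha>" "0 \<le> \<beta>"
  shows "(\<integral>\<^sup>+z'. ennreal (\<alpha> * overlap_density K s t \<phi> z z' + \<beta> * (excess K s t \<phi> z * excess K t s \<phi> z' / R)) \<partial>N) =
    ennreal (\<alpha> * (\<Sum>k<K. min (s k) (t k) / s k * \<phi> k z) + \<beta> * (excess K s t \<phi> z * (R / R)))"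
proof -
  have int: "integrable N (\<lambda>z'. \<alpha> * overlap_density K s t \<phi> z z')"
    "integrable N (\<lambda>z'. \<beta> * (excess K s t \<phi> z * excess K t s \<phi> z' / R))"
    by (intro integrable_mult_right integrable_divide integrable_overlap_density integrable_excess)+
  have "(\<integral>\<^sup>+z'. ennreal (\<alpha> * overlap_density K s t \<phi> z z' + \<beta> * (excess K s t \<phi> z * excess K t s \<phi> z' / R)) \<partial>N) =
    ennreal (\<integral>z'. \<alpha> * overlap_density K s t \<phi> z z' + \<beta> * (excess K s t \<phi> z * excess K t s \<phi> z' / R) \<partial>N)"
    using assms by (intro nn_integral_eq_integral Bochner_Integration.integrable_add int AE_I2 add_nonneg_nonneg
        mult_nonneg_nonneg divide_nonneg_nonneg overlap_density_nonneg excess_nonneg s_nonneg t_nonneg R_nonneg)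
  also have "(\<integral>z'. \<alpha> * overlap_density K s t \<phi> z z' + \<beta> * (excess K s t \<phi> z * excess K t s \<phi> z' / R) \<partial>N) =
     \<alpha> * (\<Sum>k<K. min (s k) (t k) / s k * \<phi> k z) + \<beta> * (excess K s t \<phi> z * (R / R))"
    by (subst Bochner_Integration.integral_add[OF int]) (simp add: integral_overlap_density integral_excess_N)
  finally show ?thesis .
qed

text \<open>The first marginal: overlap and excess recombine to the sum of all
  \<open>\<phi> k z\<close>, which is 1. The second marginal is the same fact with the measures
  exchanged.\<close>

lemma nn_integral_coupling_density: "AE z in M. (\<integral>\<^sup>+z'. ennreal (coupling_density K s t \<phi> z z') \<partial>N) = 1"
  using sumM AE_excess
proof eventually_elim
  case (elim z)
  have "(\<Sum>k<K. min (s k) (t k) / s k * \<phi> k z) + excess K s t \<phi> z = (\<Sum>k<K. \<phi> k z)"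
    unfolding excess_def sum.distrib[symmetric] by (rule sum.cong) (auto simp: algebra_simps)
  then show ?case
    using nn_integral_mix[of 1 1 z] elim(1)
    unfolding elim(2) by (simp add: coupling_density_def R_def[symmetric])
qed

lemma coupling_density_nonneg: "0 \<le> coupling_density K s t \<phi> z z'"
  unfolding coupling_density_def R_def[symmetric]
  by (intro add_nonneg_nonneg mult_nonneg_nonneg divide_nonneg_nonneg
        overlap_density_nonneg excess_nonneg s_nonneg t_nonneg R_nonneg)

lemma measurable_coupling_density [measurable]:
  "(\<lambda>p. coupling_density K s t \<phi> (fst p) (snd p)) \<in> borel_measurable (M \<Otimes>\<^sub>M N)"
  unfolding coupling_density_def overlap_density_def excess_def by measurable

text \<open>The overlap has mass at most 1, and the excess mass \<open>R\<close> is at most the l1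
  distance of the cell masses.\<close>

lemma nn_integral_mix2:
  assumes "0 \<le> \<alpha>" "0 \<le> \<beta>"
  shows "(\<integral>\<^sup>+z. ennreal (\<alpha> * (\<Sum>k<K. min (s k) (t k) / s k * \<phi> k z) + \<beta> * (excess K s t \<phi> z * (R / R))) \<partial>M)
     \<le> ennreal (\<alpha> + \<beta> * (\<Sum>k<K. \<bar>s k - t k\<bar>))"
proof -
  have "(\<integral>\<^sup>+z. ennreal (\<alpha> * (\<Sum>k<K. min (s k) (t k) / s k * \<phi> k z) + \<beta> * (excess K s t \<phi> z * (R / R))) \<partial>M)
     = ennreal (\<integral>z. \<alpha> * (\<Sum>k<K. min (s k) (t k) / s k * \<phi> k z) + \<beta> * (excess K s t \<phi> z * (R / R)) \<partial>M)"
    using assms by (intro nn_integral_eq_integral)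
      (auto intro!: integrable_excess add_nonneg_nonneg mult_nonneg_nonneg divide_nonneg_nonneg
        sum_nonneg excess_nonneg s_nonneg t_nonneg R_nonneg nonneg)
  also have "(\<integral>z. \<alpha> * (\<Sum>k<K. min (s k) (t k) / s k * \<phi> k z) + \<beta> * (excess K s t \<phi> z * (R / R)) \<partial>M) =
     \<alpha> * (\<Sum>k<K. min (s k) (t k) / s k * s k) + \<beta> * (R * (R / R))"
    by (subst Bochner_Integration.integral_add)
      (auto intro!: integrable_excess simp: integral_excess_M Bochner_Integration.integral_sum s_def[symmetric])
  also have "\<dots> \<le> \<alpha> * 1 + \<beta> * (\<Sum>k<K. \<bar>s k - t k\<bar>)"
  proof (intro add_mono mult_left_mono assms)
    have "(\<Sum>k<K. min (s k) (t k) / s k * s k) \<le> (\<Sum>k<K. s k)"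
      by (rule sum_mono) (use s_nonneg in auto)
    then show "(\<Sum>k<K. min (s k) (t k) / s k * s k) \<le> 1" by (simp add: sum_s)
    show "R * (R / R) \<le> (\<Sum>k<K. \<bar>s k - t k\<bar>)" using R_le by (cases "R = 0") auto
  qed
  finally show ?thesis by (simp add: ennreal_leI)
qed

end

section \<open>Marginals of a density on a product, and the resulting bound on W1\<close>

lemma distr_fst_density:
  assumes "prob_space M" "prob_space N" and H [measurable]: "H \<in> borel_measurable (M \<Otimes>\<^sub>M N)"
    and AE: "AE z in M. (\<integral>\<^sup>+z'. H (z, z') \<partial>N) = 1"
  shows "distr (density (M \<Otimes>\<^sub>M N) H) M fst = M"
proof (rule measure_eqI)
  interpret N: prob_space N by fact
  fix A assume "A \<in> sets (distr (density (M \<Otimes>\<^sub>M N) H) M fst)"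
  then have A [measurable]: "A \<in> sets M" by simp
  have "emeasure (distr (density (M \<Otimes>\<^sub>M N) H) M fst) A = (\<integral>\<^sup>+p. indicator A p \<partial>distr (density (M \<Otimes>\<^sub>M N) H) M fst)"
    by simp
  also have "\<dots> = (\<integral>\<^sup>+p. indicator A (fst p) \<partial>density (M \<Otimes>\<^sub>M N) H)"
    by (rule nn_integral_distr) auto
  also have "\<dots> = (\<integral>\<^sup>+p. H p * indicator A (fst p) \<partial>(M \<Otimes>\<^sub>M N))"
    by (rule nn_integral_density) auto
  also have "\<dots> = (\<integral>\<^sup>+z. \<integral>\<^sup>+z'. H (z, z') * indicator A z \<partial>N \<partial>M)"
    by (subst N.nn_integral_fst[symmetric]) auto
  also have "\<dots> = (\<integral>\<^sup>+z. indicator A z \<partial>M)"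
  proof (rule nn_integral_cong_AE)
    show "AE z in M. (\<integral>\<^sup>+z'. H (z, z') * indicator A z \<partial>N) = indicator A z"
      using AE AE_space by eventually_elim (simp add: nn_integral_multc)
  qed
  finally show "emeasure (distr (density (M \<Otimes>\<^sub>M N) H) M fst) A = emeasure M A" by simp
qed simp

lemma distr_snd_density:
  assumes "prob_space M" "prob_space N" and H [measurable]: "H \<in> borel_measurable (M \<Otimes>\<^sub>M N)"
    and AE: "AE z' in N. (\<integral>\<^sup>+z. H (z, z') \<partial>M) = 1"
  shows "distr (density (M \<Otimes>\<^sub>M N) H) N snd = N"
proof (rule measure_eqI)
  interpret M: prob_space M by fact
  interpret N: prob_space N by fact
  interpret pair_sigma_finite M N ..
  fix A assume "A \<in> sets (distr (density (M \<Otimes>\<^sub>M N) H) N snd)"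
  then have A [measurable]: "A \<in> sets N" by simp
  have "emeasure (distr (density (M \<Otimes>\<^sub>M N) H) N snd) A = (\<integral>\<^sup>+p. indicator A p \<partial>distr (density (M \<Otimes>\<^sub>M N) H) N snd)"
    by simp
  also have "\<dots> = (\<integral>\<^sup>+p. indicator A (snd p) \<partial>density (M \<Otimes>\<^sub>M N) H)"
    by (rule nn_integral_distr) auto
  also have "\<dots> = (\<integral>\<^sup>+p. H p * indicator A (snd p) \<partial>(M \<Otimes>\<^sub>M N))"
    by (rule nn_integral_density) auto
  also have "\<dots> = (\<integral>\<^sup>+z'. \<integral>\<^sup>+z. H (z, z') * indicator A z' \<partial>M \<partial>N)"
    by (subst nn_integral_snd[symmetric]) auto
  also have "\<dots> = (\<integral>\<^sup>+z. indicator A z \<partial>N)"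
  proof (rule nn_integral_cong_AE)
    show "AE z' in N. (\<integral>\<^sup>+z. H (z, z') * indicator A z' \<partial>M) = indicator A z'"
      using AE AE_space by eventually_elim (simp add: nn_integral_multc)
  qed
  finally show "emeasure (distr (density (M \<Otimes>\<^sub>M N) H) N snd) A = emeasure N A" by simp
qed simp

lemma borel_measurable_pt_coord [measurable]: "(\<lambda>z :: 'd::finite pt. snd z i) \<in> borel_measurable borel"
  by (rule borel_measurable_relu_fn[OF relu_fn_snd[OF lessI]])

lemma borel_measurable_pt_fst [measurable]: "(fst :: 'd::finite pt \<Rightarrow> _) \<in> borel_measurable borel"
  by (intro borel_measurable_continuous_onI continuous_intros)

lemma measurable_pdist [measurable]:
  "(\<lambda>p. pdist n (fst p) (snd p)) \<in> borel_measurable (borel \<Otimes>\<^sub>M (borel :: 'd::finite pt measure))"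
  unfolding pdist_def by measurable

text \<open>The coupling pays at most \<open>\<eta>\<close> on the overlap and at most
  \<open>B\<close> on the excess. The diameter bound holds on X only, hence the almost-everywhere
  comparisons.\<close>

lemma W1_le_partition:
  fixes \<mu> \<nu> :: "'d::finite pt measure" and K :: nat
  assumes \<mu>: "\<mu> \<in> PX X" and \<nu>: "\<nu> \<in> PX X"
    and meas [measurable]: "\<And>k. \<phi> k \<in> borel_measurable borel"
    and \<phi>: "\<And>k z. 0 \<le> \<phi> k z" "\<And>k z. \<phi> k z \<le> 1" "\<And>z. z \<in> X \<Longrightarrow> (\<Sum>k<K. \<phi> k z) = 1"
    and \<eta>: "\<And>k z z'. k < K \<Longrightarrow> 0 < \<phi> k z \<Longrightarrow> 0 < \<phi> k z' \<Longrightarrow> pdist n z z' \<le> \<eta>" "0 \<le> \<eta>"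
    and B: "\<And>z z'. z \<in> X \<Longrightarrow> z' \<in> X \<Longrightarrow> pdist n z z' \<le> B" "0 \<le> B"
  shows "W1 n \<mu> \<nu> \<le> ennreal (\<eta> + B * (\<Sum>k<K. \<bar>(\<integral>z. \<phi> k z \<partial>\<mu>) - (\<integral>z. \<phi> k z \<partial>\<nu>)\<bar>))"
proof -
  have P: "prob_space \<mu>" "prob_space \<nu>" and sets [measurable_cong]: "sets \<mu> = sets borel" "sets \<nu> = sets borel"
    using \<mu> \<nu> by (auto simp: PX_def)
  have AE: "AE z in \<rho>. z \<in> X" if "\<rho> \<in> PX X" for \<rho>
  proof -
    interpret prob_space \<rho> using that by (simp add: PX_def)
    have e: "emeasure \<rho> X = 1" using that by (simp add: PX_def)
    \<comment> \<open>A set outside the sigma-algebra has \<open>emeasure\<close> 0, so the value 1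
      makes X measurable.\<close>
    then have "X \<in> sets \<rho>" using emeasure_notin_sets by fastforce
    then show ?thesis using e by (subst AE_in_set_eq_1) (auto simp: emeasure_eq_measure)
  qed
  have AE': "AE z in \<rho>. (\<Sum>k<K. \<phi> k z) = 1" if "\<rho> \<in> PX X" for \<rho>
    using AE[OF that] by eventually_elim (rule \<phi>(3))
  interpret partition_pair \<mu> \<nu> K \<phi>
    by (intro partition_pair.intro partition_pair_axioms.intro P \<phi> AE' \<mu> \<nu>) auto
  \<comment> \<open>The pair with exchanged roles supplies the second marginal.\<close>
  interpret S: partition_pair \<nu> \<mu> K \<phi>
    by (intro partition_pair.intro partition_pair_axioms.intro P \<phi> AE' \<mu> \<nu>) auto
  have st: "S.s = t" "S.t = s" by (auto simp: fun_eq_iff S.s_def S.t_def s_def t_def)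
  define H where "H p = ennreal (coupling_density K s t \<phi> (fst p) (snd p))" for p
  define \<pi> where "\<pi> = density (\<mu> \<Otimes>\<^sub>M \<nu>) H"
  have H [measurable]: "H \<in> borel_measurable (\<mu> \<Otimes>\<^sub>M \<nu>)"
    unfolding H_def by measurable
  have 1: "distr \<pi> \<mu> fst = \<mu>"
    unfolding \<pi>_def using nn_integral_coupling_density by (intro distr_fst_density P H) (simp add: H_def)
  have 2: "distr \<pi> \<nu> snd = \<nu>"
    unfolding \<pi>_def using S.nn_integral_coupling_density
    by (intro distr_snd_density P H) (simp add: H_def st coupling_density_commute[of K t s])
  \<comment> \<open>\<open>couplings\<close> pushes forward to \<open>borel\<close>, the marginals
    above to \<open>\<mu>\<close> and \<open>\<nu>\<close>; only the sigma-algebra of the target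
    matters.\<close>
  have b: "distr \<pi> borel f = distr \<pi> \<rho> f" if "sets \<rho> = sets borel" for \<rho> :: "'d pt measure" and f
    using that by (intro distr_cong) auto
  have sp: "sets \<pi> = sets (borel \<Otimes>\<^sub>M borel)"
    unfolding \<pi>_def by (simp add: sets cong: sets_pair_measure_cong)
  have "prob_space \<pi>"
  proof (rule prob_space_distrD)
    show "fst \<in> measurable \<pi> \<mu>" unfolding \<pi>_def by simp
    show "prob_space (distr \<pi> \<mu> fst)" using 1 P by simp
  qed
  then have \<pi>: "\<pi> \<in> couplings \<mu> \<nu>"
    using 1 2 b[of \<mu> fst] b[of \<nu> snd] sets sp by (simp add: couplings_def)
  have "W1 n \<mu> \<nu> \<le> (\<integral>\<^sup>+p. ennreal (pdist n (fst p) (snd p)) \<partial>\<pi>)"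
    unfolding W1_def by (rule INF_lower[OF \<pi>])
  also have "\<dots> = (\<integral>\<^sup>+p. H p * ennreal (pdist n (fst p) (snd p)) \<partial>(\<mu> \<Otimes>\<^sub>M \<nu>))"
    unfolding \<pi>_def by (rule nn_integral_density) measurable
  also have "\<dots> = (\<integral>\<^sup>+z. \<integral>\<^sup>+z'. H (z, z') * ennreal (pdist n z z') \<partial>\<nu> \<partial>\<mu>)"
    by (subst N.nn_integral_fst[symmetric]) (auto simp: measurable_pdist)
  also have "\<dots> \<le> (\<integral>\<^sup>+z. \<integral>\<^sup>+z'. ennreal (\<eta> * overlap_density K s t \<phi> z z' + B * (excess K s t \<phi> z * excess K t s \<phi> z' / R)) \<partial>\<nu> \<partial>\<mu>)"
  proof (intro nn_integral_mono_AE)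
    show "AE z in \<mu>. (\<integral>\<^sup>+z'. H (z, z') * ennreal (pdist n z z') \<partial>\<nu>) \<le>
      (\<integral>\<^sup>+z'. ennreal (\<eta> * overlap_density K s t \<phi> z z' + B * (excess K s t \<phi> z * excess K t s \<phi> z' / R)) \<partial>\<nu>)"
      using AE[OF \<mu>]
    proof eventually_elim
      case (elim z)
      show ?case
      proof (intro nn_integral_mono_AE)
        show "AE z' in \<nu>. H (z, z') * ennreal (pdist n z z') \<le>
          ennreal (\<eta> * overlap_density K s t \<phi> z z' + B * (excess K s t \<phi> z * excess K t s \<phi> z' / R))"
          using AE[OF \<nu>]
        proof eventually_elim
          case z': (elim z')
          \<comment> \<open>Each summand charges only pairs of points in a common cell, and those
            are within \<open>\<eta>\<close>.\<close>
          have "overlap_density K s t \<phi> z z' * pdist n z z' \<le> \<eta> * overlap_density K s t \<phi> z z'"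
            unfolding overlap_density_def sum_distrib_left sum_distrib_right
          proof (rule sum_mono)
            fix k assume k: "k \<in> {..<K}"
            let ?c = "min (s k) (t k) / (s k * t k)"
            have c: "0 \<le> ?c" by (intro divide_nonneg_nonneg) (auto simp: s_nonneg t_nonneg)
            show "?c * (\<phi> k z * \<phi> k z') * pdist n z z' \<le> \<eta> * (?c * (\<phi> k z * \<phi> k z'))"
            proof (cases "0 < \<phi> k z \<and> 0 < \<phi> k z'")
              case True
              then have "pdist n z z' \<le> \<eta>" using k by (intro \<eta>(1)) auto
              then have "(?c * (\<phi> k z * \<phi> k z')) * pdist n z z' \<le> (?c * (\<phi> k z * \<phi> k z')) * \<eta>"
                using c True by (intro mult_left_mono mult_nonneg_nonneg) auto
              then show ?thesis by (simp add: mult.commute)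
            next
              case False
              then have "\<phi> k z * \<phi> k z' = 0" using \<phi>(1)[of k z] \<phi>(1)[of k z'] by auto
              then show ?thesis by (simp only: mult_zero_left mult_zero_right order_refl)
            qed
          qed
          moreover have "(excess K s t \<phi> z * excess K t s \<phi> z' / R) * pdist n z z' \<le> B * (excess K s t \<phi> z * excess K t s \<phi> z' / R)"
            using mult_left_mono[OF B(1)[OF elim z'], of "excess K s t \<phi> z * excess K t s \<phi> z' / R"]
            by (simp add: mult.commute excess_nonneg s_nonneg t_nonneg R_nonneg)
          ultimately have "coupling_density K s t \<phi> z z' * pdist n z z' \<le>
              \<eta> * overlap_density K s t \<phi> z z' + B * (excess K s t \<phi> z * excess K t s \<phi> z' / R)"
            by (simp add: coupling_density_def R_def[symmetric] distrib_right)
          then show ?case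
            by (simp add: H_def ennreal_mult'[symmetric] coupling_density_nonneg ennreal_leI)
        qed
      qed
    qed
  qed
  also have "\<dots> \<le> ennreal (\<eta> + B * (\<Sum>k<K. \<bar>s k - t k\<bar>))"
    unfolding nn_integral_mix[OF \<eta>(2) B(2)] by (rule nn_integral_mix2[OF \<eta>(2) B(2)])
  finally show ?thesis by (simp add: s_def t_def)
qed

subsection \<open>Finite nets and a ReLU partition of unity\<close>

text \<open>Pigeonhole on rounded values: the integer patterns
  \<open>\<lfloor>g i p / \<delta>\<rfloor>\<close> are finitely many, and one representative in
  \<open>S\<close> is kept for each pattern that occurs. \<open>S\<close> needs no topology, so this
  serves both for X and for pairs of a measure and a point.\<close>

lemma finite_net:
  fixes g :: "'i \<Rightarrow> 'p \<Rightarrow> real"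
  assumes I: "finite I" and \<delta>: "0 < \<delta>" and B: "\<And>i p. i \<in> I \<Longrightarrow> p \<in> S \<Longrightarrow> \<bar>g i p\<bar> \<le> B"
  shows "\<exists>P. finite P \<and> P \<subseteq> S \<and> (\<forall>p\<in>S. \<exists>q\<in>P. \<forall>i\<in>I. \<bar>g i p - g i q\<bar> < \<delta>)"
proof -
  define c where "c p = restrict (\<lambda>i. \<lfloor>g i p / \<delta>\<rfloor>) I" for p
  have "\<lfloor>g i p / \<delta>\<rfloor> \<in> {\<lfloor>- B / \<delta>\<rfloor>..\<lfloor>B / \<delta>\<rfloor>}" if "i \<in> I" "p \<in> S" for i p
  proof -
    have "- B / \<delta> \<le> g i p / \<delta>" "g i p / \<delta> \<le> B / \<delta>"
      using B[OF that] \<delta> by (intro divide_right_mono; linarith)+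
    then show ?thesis by (auto intro: floor_mono)
  qed
  then have "c ` S \<subseteq> PiE I (\<lambda>_. {\<lfloor>- B / \<delta>\<rfloor>..\<lfloor>B / \<delta>\<rfloor>})"
    by (auto simp: c_def PiE_def)
  then have "finite (c ` S)"
    by (rule finite_subset) (simp add: I finite_PiE)
  then obtain P where P: "P \<subseteq> S" "finite P" "c ` S = c ` P"
    using finite_subset_image[of "c ` S" c S] by blast
  have "\<exists>q\<in>P. \<forall>i\<in>I. \<bar>g i p - g i q\<bar> < \<delta>" if "p \<in> S" for p
  proof -
    obtain q where q: "q \<in> P" "c p = c q" using P(3) \<open>p \<in> S\<close> by (metis imageE imageI)
    have "\<bar>g i p - g i q\<bar> < \<delta>" if "i \<in> I" for i
    proof -
      have "\<lfloor>g i p / \<delta>\<rfloor> = \<lfloor>g i q / \<delta>\<rfloor>"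
        using q(2) that by (auto simp: c_def restrict_def fun_eq_iff split: if_splits)
      then have "\<bar>g i p / \<delta> - g i q / \<delta>\<bar> < 1" by linarith
      then show ?thesis using \<delta> by (simp add: diff_divide_distrib[symmetric] abs_divide divide_less_eq)
    qed
    then show ?thesis using q by blast
  qed
  then show ?thesis using P by blast
qed

text \<open>A substitute for \<open>pdist\<close> that ReLU networks compute exactly; the Euclidean
  norm is not piecewise linear.\<close>

definition l1dist :: "nat \<Rightarrow> 'd::finite pt \<Rightarrow> 'd pt \<Rightarrow> real" where
  "l1dist n z z' = (\<Sum>j\<in>UNIV. \<bar>fst z $ j - fst z' $ j\<bar>) + (\<Sum>i<n. \<bar>snd z i - snd z' i\<bar>)"

lemma pdist_le_l1dist: "pdist n z z' \<le> l1dist n z z'"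
proof -
  have "pdist n z z' \<le> sqrt ((norm (fst z - fst z'))\<^sup>2) + sqrt (\<Sum>i<n. (snd z i - snd z' i)\<^sup>2)"
    unfolding pdist_def by (rule sqrt_add_le_add_sqrt) (auto intro: sum_nonneg)
  also have "sqrt (\<Sum>i<n. (snd z i - snd z' i)\<^sup>2) \<le> (\<Sum>i<n. \<bar>snd z i - snd z' i\<bar>)"
    using L2_set_le_sum_abs[of "\<lambda>i. snd z i - snd z' i" "{..<n}"] by (simp add: L2_set_def)
  also have "sqrt ((norm (fst z - fst z'))\<^sup>2) \<le> (\<Sum>j\<in>UNIV. \<bar>fst z $ j - fst z' $ j\<bar>)"
    using norm_le_l1_cart[of "fst z - fst z'"] by simp
  finally show ?thesis by (simp add: l1dist_def)
qed

lemma l1dist_triangle: "l1dist n z z' \<le> l1dist n z q + l1dist n z' q"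
proof -
  have "l1dist n z z' \<le> (\<Sum>j\<in>UNIV. \<bar>fst z $ j - fst q $ j\<bar> + \<bar>fst z' $ j - fst q $ j\<bar>) +
      (\<Sum>i<n. \<bar>snd z i - snd q i\<bar> + \<bar>snd z' i - snd q i\<bar>)"
    unfolding l1dist_def by (intro add_mono sum_mono) auto
  then show ?thesis by (simp add: l1dist_def sum.distrib)
qed

fun running_max :: "(nat \<Rightarrow> 'a \<Rightarrow> real) \<Rightarrow> nat \<Rightarrow> 'a \<Rightarrow> real" where
  "running_max \<psi> 0 z = 0"
| "running_max \<psi> (Suc k) z = max (running_max \<psi> k z) (\<psi> k z)"

lemma running_max_le_1: "(\<And>k. \<psi> k z \<le> 1) \<Longrightarrow> running_max \<psi> k z \<le> 1"
  by (induction k) auto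

lemma running_max_nonneg: "0 \<le> running_max \<psi> k z"
  by (induction k) auto

lemma running_max_ge: "j < k \<Longrightarrow> \<psi> j z \<le> running_max \<psi> k z"
  by (induction k) (auto simp: less_Suc_eq)

lemma relu_fn_running_max: "(\<And>k. relu_fn m (\<psi> k)) \<Longrightarrow> relu_fn m (running_max \<psi> k)"
proof (induction k)
  case (Suc k)
  then have "relu_fn m (\<lambda>z. max (running_max \<psi> k z) (\<psi> k z))" by (intro relu_fn_max) auto
  then show ?case by (rule back_subst[of "relu_fn m"]) auto
next
  case 0
  have "running_max \<psi> 0 = (\<lambda>z. 0)" by auto
  then show ?case by (simp only: relu_fn_const)
qed

text \<open>Increments of the running maximum of bumps form a partition of unity; the usual normalised
  or tensor-product constructions need multiplications, which ReLU networks cannot do exactly.\<close>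

lemma relu_partition_of_unity:
  fixes \<Omega> :: "(real^'d::finite) set"
  assumes bdd: "bounded \<Omega>" and L: "0 < L" and n: "0 < n" and \<eta>: "0 < \<eta>"
  shows "\<exists>(K::nat) \<phi>. (\<forall>k. relu_fn n (\<phi> k)) \<and> (\<forall>k z. 0 \<le> \<phi> k z \<and> \<phi> k z \<le> 1) \<and>
     (\<forall>z\<in>Xset \<Omega> n L. (\<Sum>k<K. \<phi> k z) = 1) \<and>
     (\<forall>k<K. \<forall>z z'. 0 < \<phi> k z \<longrightarrow> 0 < \<phi> k z' \<longrightarrow> pdist n z z' \<le> \<eta>)"
proof -
  \<comment> \<open>Supports will have \<open>l1dist\<close> radius \<open>2 * r\<close>, so two
    points of one support are within \<open>4 * r = \<eta>\<close>. Below, \<open>\<delta>\<close>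
    spreads \<open>r\<close> over the d + n coordinates.\<close>
  define r where "r = \<eta> / 4"
  have r: "0 < r" using \<eta> by (simp add: r_def)
  define \<delta> where "\<delta> = r / (CARD('d) + n)"
  have \<delta>: "0 < \<delta>" using r n by (simp add: \<delta>_def)
  obtain B where B: "\<And>x. x \<in> closure \<Omega> \<Longrightarrow> norm x \<le> B"
    using bounded_closure[OF bdd] unfolding bounded_iff by metis
  define g where "g = (\<lambda>i (z :: 'd pt). case i of Inl j \<Rightarrow> fst z $ j | Inr i \<Rightarrow> snd z i)"
  have "\<bar>g i z\<bar> \<le> max B L" if "i \<in> UNIV <+> {..<n}" "z \<in> Xset \<Omega> n L" for i z
    using that B[of "fst z"]
    by (auto simp: g_def Xset_def Ybox_def le_max_iff_disj intro: order_trans[OF component_le_norm_cart])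
  from finite_net[where I = "UNIV <+> {..<n}" and S = "Xset \<Omega> n L" and g = g, OF _ \<delta> this]
  obtain P where P: "finite P" "P \<subseteq> Xset \<Omega> n L"
    "\<And>z. z \<in> Xset \<Omega> n L \<Longrightarrow> \<exists>q\<in>P. \<forall>i\<in>UNIV <+> {..<n}. \<bar>g i z - g i q\<bar> < \<delta>"
    by auto
  have cover: "\<exists>q\<in>P. l1dist n z q \<le> r" if z: "z \<in> Xset \<Omega> n L" for z
  proof -
    obtain q where q: "q \<in> P" "\<forall>i\<in>UNIV <+> {..<n}. \<bar>g i z - g i q\<bar> < \<delta>" using P(3)[OF z] by blast
    have "\<bar>fst z $ j - fst q $ j\<bar> \<le> \<delta>" for j
      using bspec[OF q(2) InlI[OF UNIV_I], of j] by (simp add: g_def)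
    moreover have "\<bar>snd z i - snd q i\<bar> \<le> \<delta>" if "i < n" for i
      using bspec[OF q(2) InrI, of i] that by (simp add: g_def)
    ultimately have "l1dist n z q \<le> (\<Sum>j\<in>(UNIV :: 'd set). \<delta>) + (\<Sum>i<n. \<delta>)"
      unfolding l1dist_def by (intro add_mono sum_mono) auto
    also have "\<dots> = (CARD('d) + n) * \<delta>" by (simp add: algebra_simps)
    also have "\<dots> = r" using n by (simp add: \<delta>_def)
    finally show ?thesis using q(1) by blast
  qed
  obtain qs where qs: "set qs = P" using finite_list[OF P(1)] by blast
  \<comment> \<open>A trapezoid: 1 up to distance \<open>r\<close> from the net point, 0 from
    distance \<open>2 * r\<close> on.\<close>
  define \<psi> where "\<psi> k z = max 0 (min 1 (2 - 1 / r * l1dist n z (qs ! k)))" for k z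
  have \<psi>: "relu_fn n (\<psi> k)" for k
    unfolding \<psi>_def[abs_def] l1dist_def by (intro relu_fn_intros) auto
  have \<psi>01: "0 \<le> \<psi> k z" "\<psi> k z \<le> 1" for k z by (auto simp: \<psi>_def)
  have \<psi>1: "\<psi> k z = 1" if "l1dist n z (qs ! k) \<le> r" for k z
    using that r by (auto simp: \<psi>_def field_simps)
  have \<psi>pos: "l1dist n z (qs ! k) < 2 * r" if "0 < \<psi> k z" for k z
    using that r by (auto simp: \<psi>_def field_simps less_max_iff_disj)
  define \<phi> where "\<phi> k z = running_max \<psi> (Suc k) z - running_max \<psi> k z" for k z
  have \<phi>01: "0 \<le> \<phi> k z" "\<phi> k z \<le> 1" for k z
    using running_max_nonneg[of \<psi> k z] \<psi>01[of k z] by (auto simp: \<phi>_def)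
  have "relu_fn n (\<phi> k)" for k
    unfolding \<phi>_def[abs_def] by (intro relu_fn_diff relu_fn_running_max \<psi>)
  moreover have "(\<Sum>k<length qs. \<phi> k z) = 1" if z: "z \<in> Xset \<Omega> n L" for z
  proof -
    obtain k where k: "k < length qs" "l1dist n z (qs ! k) \<le> r"
      using cover[OF z] qs by (metis in_set_conv_nth)
    have "(\<Sum>k<length qs. \<phi> k z) = running_max \<psi> (length qs) z"
      unfolding \<phi>_def using sum_lessThan_telescope[of "\<lambda>k. running_max \<psi> k z"] by simp
    then show ?thesis
      using running_max_ge[OF k(1), of \<psi> z] \<psi>1[OF k(2)] running_max_le_1[of \<psi> z "length qs", OF \<psi>01(2)] by simp
  qed
  moreover have "pdist n z z' \<le> \<eta>" if "0 < \<phi> k z" "0 < \<phi> k z'" for k z z'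
  proof -
    \<comment> \<open>The running maximum is nonnegative, so it can increase at step k only where
      \<open>\<psi> k\<close> is positive.\<close>
    have "0 < \<psi> k z" if "0 < \<phi> k z" for z
      using that running_max_nonneg[of \<psi> k z] by (auto simp: \<phi>_def max_def split: if_splits)
    then have "l1dist n z (qs ! k) < 2 * r" "l1dist n z' (qs ! k) < 2 * r" using that \<psi>pos by auto
    then show ?thesis
      using pdist_le_l1dist[of n z z'] l1dist_triangle[of n z z' "qs ! k"] by (simp add: r_def)
  qed
  ultimately show ?thesis
    using \<phi>01 by (intro exI[of _ "length qs"] exI[of _ \<phi>]) blast
qed

subsection \<open>Uniform approximation\<close>

text \<open>From below, a net point with small penalty already reaches \<open>f - 2 * e\<close>.
  From above, points within \<open>\<delta>\<close> have values at most \<open>f + e\<close>, and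
  farther ones lose at least \<open>2 * L\<close>, which exceeds any gain in value. The entry
  \<open>- L\<close> is harmless because \<open>f\<close> is never below it.\<close>

lemma Max_McShane_approx:
  fixes f :: real and v \<rho> :: "'p \<Rightarrow> real"
  assumes P: "finite P" and f: "\<bar>f\<bar> \<le> L" and v: "\<And>p. p \<in> P \<Longrightarrow> \<bar>v p\<bar> \<le> L" and \<rho>: "\<And>p. p \<in> P \<Longrightarrow> 0 \<le> \<rho> p"
    and \<delta>: "0 < \<delta>" and e: "0 < e" and close: "\<And>p. p \<in> P \<Longrightarrow> \<rho> p < \<delta> \<Longrightarrow> \<bar>f - v p\<bar> \<le> e"
    and K: "K * \<delta> = 2 * L" "0 \<le> K"
    and net: "\<exists>p\<in>P. \<rho> p < \<delta> \<and> K * \<rho> p \<le> e"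
  shows "\<bar>Max (insert (- L) ((\<lambda>p. v p - K * \<rho> p) ` P)) - f\<bar> \<le> 2 * e"
proof -
  let ?S = "insert (- L) ((\<lambda>p. v p - K * \<rho> p) ` P)"
  obtain p where p: "p \<in> P" "\<rho> p < \<delta>" "K * \<rho> p \<le> e" using net by blast
  have "v p - K * \<rho> p \<le> Max ?S" using P p by (intro Max_ge) auto
  then have "f - 2 * e \<le> Max ?S" using close[OF p(1,2)] p(3) by linarith
  moreover have "Max ?S \<le> f + e"
  proof (rule Max.boundedI)
    fix a assume "a \<in> ?S"
    then consider "a = - L" | p where "p \<in> P" "a = v p - K * \<rho> p" by auto
    then show "a \<le> f + e"
    proof cases
      case 1
      then show ?thesis using f e by linarith
    next
      case (2 p)
      show ?thesis
      proof (cases "\<rho> p < \<delta>")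
        case True
        then show ?thesis using close[OF 2(1)] 2(2) mult_nonneg_nonneg[OF K(2) \<rho>[OF 2(1)]] by linarith
      next
        case False
        then have "2 * L \<le> K * \<rho> p" using mult_left_mono[OF _ K(2), of \<delta> "\<rho> p"] K(1) by linarith
        then show ?thesis using v[OF 2(1)] f e 2(2) by linarith
      qed
    qed
  qed (use P in auto)
  ultimately show ?thesis using e by linarith
qed

lemma abs_le_ydist: "i < n \<Longrightarrow> \<bar>y i - y' i\<bar> \<le> ydist n y y'"
  using member_le_L2_set[of "{..<n}" i "\<lambda>i. \<bar>y i - y' i\<bar>"] by (simp add: ydist_def L2_set_def)

section \<open>Pushforwards of measures on X\<close>

lemma prob_space_restrict_PX:
  assumes "\<mu> \<in> PX X"
  shows "prob_space (restrict_space \<mu> X)" "space (restrict_space \<mu> X) = X" "emeasure (restrict_space \<mu> X) X = 1"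
    "sets (restrict_space \<mu> X) = sets (restrict_space borel X)"
proof -
  have e: "emeasure \<mu> X = 1" and s: "sets \<mu> = sets borel" using assms by (auto simp: PX_def)
  then have X: "X \<in> sets \<mu>" using emeasure_notin_sets by fastforce
  then have sub: "X \<subseteq> space \<mu>" by (rule sets.sets_into_space)
  show sp: "space (restrict_space \<mu> X) = X" using sub by (auto simp: space_restrict_space)
  show em: "emeasure (restrict_space \<mu> X) X = 1"
    using X e sub by (subst emeasure_restrict_space) (auto simp: Int_absorb2)
  show "prob_space (restrict_space \<mu> X)" by (rule prob_spaceI) (simp add: sp em)
  show "sets (restrict_space \<mu> X) = sets (restrict_space borel X)"
    by (simp add: sets_restrict_space s)
qed

lemma pushX_in_PX:
  assumes \<mu>: "\<mu> \<in> PX X" and F: "F \<in> measurable (restrict_space \<mu> X) borel" and FX: "\<And>z. z \<in> X \<Longrightarrow> F z \<in> X"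
  shows "pushX X \<mu> F \<in> PX X"
proof -
  interpret prob_space "restrict_space \<mu> X" by (rule prob_space_restrict_PX[OF \<mu>])
  have "X \<in> sets borel"
    using \<mu> emeasure_notin_sets[of X \<mu>] by (fastforce simp: PX_def)
  then have "emeasure (pushX X \<mu> F) X = emeasure (restrict_space \<mu> X) (F -` X \<inter> X)"
    unfolding pushX_def using F by (subst emeasure_distr) (auto simp: prob_space_restrict_PX[OF \<mu>])
  also have "F -` X \<inter> X = X" using FX by auto
  finally show ?thesis
    using prob_space_distr[OF F] by (simp add: PX_def prob_space_restrict_PX[OF \<mu>]) (simp add: pushX_def)
qed

text \<open>The law of the pair \<open>(F z, G z)\<close> couples the two pushforwards and never
  moves mass farther than \<open>\<epsilon>\<close>.\<close>

lemma W1_pushX_le: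
  assumes \<mu>: "\<mu> \<in> PX X" and F [measurable]: "F \<in> measurable (restrict_space \<mu> X) borel"
    and G [measurable]: "G \<in> measurable (restrict_space \<mu> X) borel"
    and le: "\<And>z. z \<in> X \<Longrightarrow> pdist n (F z) (G z) \<le> \<epsilon>"
  shows "W1 n (pushX X \<mu> F) (pushX X \<mu> G) \<le> ennreal \<epsilon>"
proof -
  let ?M = "restrict_space \<mu> X"
  interpret prob_space ?M by (rule prob_space_restrict_PX[OF \<mu>])
  define \<pi> where "\<pi> = distr ?M (borel \<Otimes>\<^sub>M borel) (\<lambda>z. (F z, G z))"
  have FG: "(\<lambda>z. (F z, G z)) \<in> measurable ?M (borel \<Otimes>\<^sub>M borel)" by simp
  have "\<pi> \<in> couplings (pushX X \<mu> F) (pushX X \<mu> G)"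
    using prob_space_distr[OF FG] by (simp add: couplings_def \<pi>_def pushX_def distr_distr comp_def)
  then have "W1 n (pushX X \<mu> F) (pushX X \<mu> G) \<le> (\<integral>\<^sup>+p. ennreal (pdist n (fst p) (snd p)) \<partial>\<pi>)"
    unfolding W1_def by (rule INF_lower)
  also have "\<dots> = (\<integral>\<^sup>+z. ennreal (pdist n (F z) (G z)) \<partial>?M)"
    unfolding \<pi>_def by (subst nn_integral_distr[OF FG]) auto
  also have "\<dots> \<le> (\<integral>\<^sup>+z. ennreal \<epsilon> \<partial>?M)"
    by (intro nn_integral_mono ennreal_leI le) (simp add: prob_space_restrict_PX(2)[OF \<mu>])
  also have "\<dots> = ennreal \<epsilon>" by (simp add: emeasure_space_1)
  finally show ?thesis .
qed

text \<open>Half of \<open>\<delta>\<close> pays for moves inside cells, the other half for the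
  excess carried across X; hence cells of diameter \<open>\<delta> / 2\<close> and
  \<open>\<delta>' = \<delta> / (2 * B)\<close>.\<close>

lemma W1_modulus_by_statistics:
  fixes \<Omega> :: "(real^'d::finite) set"
  assumes bdd: "bounded \<Omega>" and L: "0 < L" and n: "0 < n" and \<delta>: "0 < \<delta>"
  shows "\<exists>(N::nat) \<phi> \<delta>'. 0 < \<delta>' \<and> (\<forall>k. relu_fn n (\<phi> k)) \<and> (\<forall>k z. 0 \<le> \<phi> k z \<and> \<phi> k z \<le> 1) \<and>
     (\<forall>\<mu>\<in>PX (Xset \<Omega> n L). \<forall>\<nu>\<in>PX (Xset \<Omega> n L).
        (\<Sum>k<N. \<bar>(\<integral>z. \<phi> k z \<partial>\<mu>) - (\<integral>z. \<phi> k z \<partial>\<nu>)\<bar>) < \<delta>' \<longrightarrow> W1 n \<mu> \<nu> < ennreal \<delta>)"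
proof -
  obtain N :: nat and \<phi> :: "nat \<Rightarrow> 'd pt \<Rightarrow> real" where \<phi>: "\<And>k. relu_fn n (\<phi> k)" "\<And>k z. 0 \<le> \<phi> k z" "\<And>k z. \<phi> k z \<le> 1"
     "\<And>z. z \<in> Xset \<Omega> n L \<Longrightarrow> (\<Sum>k<N. \<phi> k z) = 1"
     "\<And>k z z'. k < N \<Longrightarrow> 0 < \<phi> k z \<Longrightarrow> 0 < \<phi> k z' \<Longrightarrow> pdist n z z' \<le> \<delta> / 2"
    using relu_partition_of_unity[OF bdd L n half_gt_zero[OF \<delta>]] by metis
  obtain B0 where B0: "\<And>x. x \<in> closure \<Omega> \<Longrightarrow> norm x \<le> B0"
    using bounded_closure[OF bdd] unfolding bounded_iff by metis
  \<comment> \<open>A crude l1 diameter of X, made positive by its second term so that it may stand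
    in a denominator.\<close>
  define B where "B = CARD('d) * (2 * \<bar>B0\<bar>) + n * (2 * L)"
  have B: "0 < B" using L n by (simp add: B_def add_nonneg_pos)
  have diam: "pdist n z z' \<le> B" if z: "z \<in> Xset \<Omega> n L" and z': "z' \<in> Xset \<Omega> n L" for z z'
  proof -
    have "\<bar>fst z $ j - fst z' $ j\<bar> \<le> 2 * \<bar>B0\<bar>" for j
      using component_le_norm_cart[of "fst z" j] component_le_norm_cart[of "fst z'" j]
        B0[of "fst z"] B0[of "fst z'"] z z' by (auto simp: Xset_def)
    moreover have "\<bar>snd z i - snd z' i\<bar> \<le> 2 * L" if "i < n" for i
    proof -
      have "\<bar>snd z i\<bar> \<le> L" "\<bar>snd z' i\<bar> \<le> L" using z z' that by (auto simp: Xset_def Ybox_def)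
      then show ?thesis by linarith
    qed
    ultimately have "l1dist n z z' \<le> (\<Sum>j\<in>(UNIV :: 'd set). 2 * \<bar>B0\<bar>) + (\<Sum>i<n. 2 * L)"
      unfolding l1dist_def by (intro add_mono sum_mono) auto
    then show ?thesis using pdist_le_l1dist[of n z z'] by (simp add: B_def)
  qed
  have "W1 n \<mu> \<nu> < ennreal \<delta>" if \<mu>: "\<mu> \<in> PX (Xset \<Omega> n L)" and \<nu>: "\<nu> \<in> PX (Xset \<Omega> n L)"
    and *: "(\<Sum>k<N. \<bar>(\<integral>z. \<phi> k z \<partial>\<mu>) - (\<integral>z. \<phi> k z \<partial>\<nu>)\<bar>) < \<delta> / (2 * B)" for \<mu> \<nu>
  proof -
    have "W1 n \<mu> \<nu> \<le> ennreal (\<delta> / 2 + B * (\<Sum>k<N. \<bar>(\<integral>z. \<phi> k z \<partial>\<mu>) - (\<integral>z. \<phi> k z \<partial>\<nu>)\<bar>))"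
      using \<delta> B by (intro W1_le_partition[OF \<mu> \<nu>] borel_measurable_relu_fn[OF \<phi>(1)] \<phi>(2-5) diam) auto
    also have "\<dots> < ennreal \<delta>"
      using mult_strict_left_mono[OF * B] B \<delta> by (intro ennreal_lessI) auto
    finally show ?thesis .
  qed
  moreover have "0 < \<delta> / (2 * B)" using \<delta> B by simp
  ultimately show ?thesis using \<phi>(1-3) by blast
qed

lemma computable_approximation:
  fixes \<Omega> :: "(real^'d::finite) set" and f :: "'d pt measure \<Rightarrow> real^'d \<Rightarrow> nat \<Rightarrow> real"
  assumes bdd: "bounded \<Omega>" and L: "0 < L" and n: "0 < n" and e: "0 < e"
    and range: "\<And>\<mu> x. \<mu> \<in> PX (Xset \<Omega> n L) \<Longrightarrow> x \<in> closure \<Omega> \<Longrightarrow> f \<mu> x \<in> Ybox n L"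
    and unif_cont: "\<forall>e>0. \<exists>\<delta>>0. \<forall>\<mu>\<in>PX (Xset \<Omega> n L). \<forall>\<nu>\<in>PX (Xset \<Omega> n L). \<forall>x\<in>closure \<Omega>.
         W1 n \<mu> \<nu> < ennreal \<delta> \<longrightarrow> ydist n (f \<mu> x) (f \<nu> x) < e"
    and lip: "\<exists>C. \<forall>\<mu>\<in>PX (Xset \<Omega> n L). \<forall>x\<in>closure \<Omega>. \<forall>x'\<in>closure \<Omega>.
         ydist n (f \<mu> x) (f \<mu> x') \<le> C * norm (x - x')"
  shows "\<exists>A. computable n A \<and> (\<forall>\<mu>\<in>PX (Xset \<Omega> n L). \<forall>x\<in>closure \<Omega>. \<forall>i<n.
    \<bar>A \<mu> x i\<bar> \<le> L \<and> \<bar>A \<mu> x i - f \<mu> x i\<bar> \<le> 2 * e)"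
proof -
  let ?PX = "PX (Xset \<Omega> n L)"
  obtain \<delta>1 where \<delta>1: "0 < \<delta>1" "\<And>\<mu> \<nu> x. \<mu> \<in> ?PX \<Longrightarrow> \<nu> \<in> ?PX \<Longrightarrow> x \<in> closure \<Omega> \<Longrightarrow>
      W1 n \<mu> \<nu> < ennreal \<delta>1 \<Longrightarrow> ydist n (f \<mu> x) (f \<nu> x) < e / 2"
    using unif_cont e half_gt_zero by metis
  obtain C0 where C0: "\<And>\<mu> x x'. \<mu> \<in> ?PX \<Longrightarrow> x \<in> closure \<Omega> \<Longrightarrow> x' \<in> closure \<Omega> \<Longrightarrow>
      ydist n (f \<mu> x) (f \<mu> x') \<le> C0 * norm (x - x')"
    using lip by blast
  \<comment> \<open>\<open>C0\<close> may be zero or negative; \<open>C\<close> is a Lipschitz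
    constant one can divide by.\<close>
  define C where "C = \<bar>C0\<bar> + 1"
  obtain N :: nat and \<phi> :: "nat \<Rightarrow> 'd pt \<Rightarrow> real" and \<delta>2 where \<delta>2: "0 < \<delta>2"
    and \<phi>': "\<forall>k. relu_fn n (\<phi> k)" "\<forall>k z. 0 \<le> \<phi> k z \<and> \<phi> k z \<le> 1"
    and W': "\<forall>\<mu>\<in>?PX. \<forall>\<nu>\<in>?PX.
        (\<Sum>k<N. \<bar>(\<integral>z. \<phi> k z \<partial>\<mu>) - (\<integral>z. \<phi> k z \<partial>\<nu>)\<bar>) < \<delta>2 \<longrightarrow> W1 n \<mu> \<nu> < ennreal \<delta>1"
    using W1_modulus_by_statistics[OF bdd L n \<delta>1(1)] by (elim exE conjE)
  note \<phi> = \<phi>'[rule_format] and W = W'[rule_format]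
  define \<rho> where "\<rho> \<mu> x p = (\<Sum>j\<in>UNIV. \<bar>x $ j - snd p $ j\<bar>) + (\<Sum>k<N. \<bar>(\<integral>z. \<phi> k z \<partial>\<mu>) - (\<integral>z. \<phi> k z \<partial>fst p)\<bar>)"
    for \<mu> x and p :: "'d pt measure \<times> (real^'d)"
  \<comment> \<open>Half of \<open>e\<close> goes to the change of measure and half to the change of
    point, through the intermediate pair \<open>(fst p, x)\<close>.\<close>
  define \<delta> where "\<delta> = min \<delta>2 (e / (2 * C))"
  have \<delta>: "0 < \<delta>" using \<delta>2 e by (simp add: \<delta>_def C_def)
  have close: "\<bar>f \<mu> x i - f (fst p) (snd p) i\<bar> \<le> e"
    if \<mu>: "\<mu> \<in> ?PX" and x: "x \<in> closure \<Omega>" and p: "p \<in> ?PX \<times> closure \<Omega>" and i: "i < n" and \<rho>: "\<rho> \<mu> x p < \<delta>" for \<mu> x p i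
  proof -
    have nn: "0 \<le> (\<Sum>j\<in>UNIV. \<bar>x $ j - snd p $ j\<bar>)" "0 \<le> (\<Sum>k<N. \<bar>(\<integral>z. \<phi> k z \<partial>\<mu>) - (\<integral>z. \<phi> k z \<partial>fst p)\<bar>)"
      by (auto intro: sum_nonneg)
    have lt: "(\<Sum>j\<in>UNIV. \<bar>x $ j - snd p $ j\<bar>) < e / (2 * C)"
      "(\<Sum>k<N. \<bar>(\<integral>z. \<phi> k z \<partial>\<mu>) - (\<integral>z. \<phi> k z \<partial>fst p)\<bar>) < \<delta>2"
      using \<rho> nn unfolding \<rho>_def \<delta>_def by linarith+
    have "W1 n \<mu> (fst p) < ennreal \<delta>1"
      using \<mu> p lt(2) by (intro W) auto
    then have 1: "ydist n (f \<mu> x) (f (fst p) x) < e / 2"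
      using \<mu> p x by (intro \<delta>1(2)) auto
    have "norm (x - snd p) \<le> (\<Sum>j\<in>UNIV. \<bar>x $ j - snd p $ j\<bar>)"
      using norm_le_l1_cart[of "x - snd p"] by simp
    then have "norm (x - snd p) < e / (2 * C)"
      using lt(1) by linarith
    then have "C * norm (x - snd p) < e / 2"
      by (simp add: C_def field_simps)
    moreover have "C0 * norm (x - snd p) \<le> C * norm (x - snd p)"
      by (rule mult_right_mono) (auto simp: C_def)
    ultimately have 2: "ydist n (f (fst p) x) (f (fst p) (snd p)) < e / 2"
      using C0[of "fst p" x "snd p"] p x by fastforce
    show ?thesis
      using 1 2 abs_le_ydist[OF i, of "f \<mu> x" "f (fst p) x"] abs_le_ydist[OF i, of "f (fst p) x" "f (fst p) (snd p)"]
      by linarith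
  qed
  \<comment> \<open>At distance \<open>\<delta>\<close> the penalty equals \<open>2 * L\<close>, the
    largest possible difference of two values.\<close>
  define K where "K = 2 * L / \<delta>"
  have K: "0 < K" "K * \<delta> = 2 * L" using L \<delta> by (auto simp: K_def)
  \<comment> \<open>\<open>\<delta> / 2\<close> puts the nearest net point strictly within
    \<open>\<delta>\<close>, \<open>e / K\<close> keeps its penalty below \<open>e\<close>.\<close>
  define r where "r = min (\<delta> / 2) (e / K)"
  have r: "0 < r" using \<delta> e K by (simp add: r_def)
  define \<eta> where "\<eta> = r / (CARD('d) + N)"
  have card: "0 < real CARD('d) + real N" by (simp add: card_gt_0_iff add_pos_nonneg)
  then have \<eta>: "0 < \<eta>" using r by (simp add: \<eta>_def)
  obtain B where B: "\<And>x. x \<in> closure \<Omega> \<Longrightarrow> norm x \<le> B"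
    using bounded_closure[OF bdd] unfolding bounded_iff by metis
  define g where "g = (\<lambda>i (p :: 'd pt measure \<times> (real^'d)). case i of Inl j \<Rightarrow> snd p $ j | Inr k \<Rightarrow> \<integral>z. \<phi> k z \<partial>fst p)"
  have int01: "\<bar>\<integral>z. \<phi> k z \<partial>\<mu>\<bar> \<le> 1" if "\<mu> \<in> ?PX" for \<mu> k
  proof -
    interpret prob_space \<mu> using that by (simp add: PX_def)
    have m: "\<phi> k \<in> borel_measurable \<mu>"
      using borel_measurable_relu_fn[OF \<phi>(1)] that by (simp add: PX_def cong: measurable_cong_sets)
    then have "integrable \<mu> (\<phi> k)" by (intro integrable_const_bound[of _ 1]) (auto simp: \<phi>(2))
    then have "(\<integral>z. \<phi> k z \<partial>\<mu>) \<le> 1" by (intro integral_le_const) (auto simp: \<phi>(2))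
    moreover have "0 \<le> (\<integral>z. \<phi> k z \<partial>\<mu>)" by (simp add: \<phi>(2))
    ultimately show ?thesis by simp
  qed
  have bound: "\<bar>g i p\<bar> \<le> max B 1" if "i \<in> UNIV <+> {..<N}" "p \<in> ?PX \<times> closure \<Omega>" for i p
    using that B[of "snd p"] int01[of "fst p"]
    by (auto simp: g_def le_max_iff_disj intro: order_trans[OF component_le_norm_cart])
  \<comment> \<open>Net points are genuine pairs of a measure on X and a point, so the values of
    \<open>f\<close> there lie in the box and can be stored as network constants.\<close>
  have "\<exists>P. finite P \<and> P \<subseteq> ?PX \<times> closure \<Omega> \<and>
      (\<forall>p\<in>?PX \<times> closure \<Omega>. \<exists>q\<in>P. \<forall>i\<in>UNIV <+> {..<N}. \<bar>g i p - g i q\<bar> < \<eta>)"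
    by (rule finite_net[where B = "max B 1"]) (simp_all add: \<eta> bound del: max.bounded_iff le_max_iff_disj)
  then obtain P where P: "finite P" "P \<subseteq> ?PX \<times> closure \<Omega>"
    and P': "\<forall>p\<in>?PX \<times> closure \<Omega>. \<exists>q\<in>P. \<forall>i\<in>UNIV <+> {..<N}. \<bar>g i p - g i q\<bar> < \<eta>"
    by (elim exE conjE)
  have net: "\<exists>p\<in>P. \<rho> \<mu> x p < \<delta> \<and> K * \<rho> \<mu> x p \<le> e" if \<mu>: "\<mu> \<in> ?PX" and x: "x \<in> closure \<Omega>" for \<mu> x
  proof -
    obtain q where q: "q \<in> P" "\<forall>i\<in>UNIV <+> {..<N}. \<bar>g i (\<mu>, x) - g i q\<bar> < \<eta>"
      using bspec[OF P', of "(\<mu>, x)"] \<mu> x by blast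
    have "\<bar>x $ j - snd q $ j\<bar> \<le> \<eta>" for j
      using bspec[OF q(2) InlI[OF UNIV_I], of j] by (simp add: g_def)
    moreover have "\<bar>(\<integral>z. \<phi> k z \<partial>\<mu>) - (\<integral>z. \<phi> k z \<partial>fst q)\<bar> \<le> \<eta>" if "k < N" for k
      using bspec[OF q(2) InrI, of k] that by (simp add: g_def)
    ultimately have "\<rho> \<mu> x q \<le> (\<Sum>j\<in>(UNIV :: 'd set). \<eta>) + (\<Sum>k<N. \<eta>)"
      unfolding \<rho>_def by (intro add_mono sum_mono) auto
    also have "\<dots> = (CARD('d) + N) * \<eta>" by (simp add: algebra_simps)
    also have "\<dots> = r" using card by (simp add: \<eta>_def)
    finally have "\<rho> \<mu> x q \<le> \<delta> / 2" "\<rho> \<mu> x q \<le> e / K" by (auto simp: r_def)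
    then show ?thesis
      using \<delta> K(1) q(1) by (intro bexI[of _ q]) (auto simp: field_simps)
  qed
  obtain A where A: "computable n A" "\<And>\<mu> x i. i < n \<Longrightarrow> A \<mu> x i =
      Max (insert (- L) ((\<lambda>p. f (fst p) (snd p) i - K * \<rho> \<mu> x p) ` P))"
    using computable_Max[OF P(1), of N n \<phi> "- L" "\<lambda>p i. f (fst p) (snd p) i" K snd "\<lambda>p k. \<integral>z. \<phi> k z \<partial>fst p"] \<phi>(1)
    unfolding \<rho>_def by blast
  have fL: "\<bar>f \<mu> x i\<bar> \<le> L" if "\<mu> \<in> ?PX" "x \<in> closure \<Omega>" "i < n" for \<mu> x i
    using range[OF that(1,2)] that(3) by (simp add: Ybox_def)
  have pL: "\<bar>f (fst p) (snd p) i\<bar> \<le> L" if "p \<in> P" "i < n" for p i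
    using that P(2) by (intro fL) auto
  have \<rho>0: "0 \<le> \<rho> \<mu> x p" for \<mu> x p
    unfolding \<rho>_def by (intro add_nonneg_nonneg sum_nonneg) auto
  have "\<bar>A \<mu> x i\<bar> \<le> L \<and> \<bar>A \<mu> x i - f \<mu> x i\<bar> \<le> 2 * e"
    if \<mu>: "\<mu> \<in> ?PX" and x: "x \<in> closure \<Omega>" and i: "i < n" for \<mu> x i
  proof
    show "\<bar>A \<mu> x i - f \<mu> x i\<bar> \<le> 2 * e"
      unfolding A(2)[OF i] using P(2) K(1)
      by (intro Max_McShane_approx[where \<delta> = \<delta>] P(1) fL \<mu> x i pL \<rho>0 \<delta> e close K net) auto
    \<comment> \<open>Penalties only lower values, and the entry \<open>- L\<close> bounds the
      maximum from below, so the output stays in the box without clipping.\<close>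
    have "A \<mu> x i \<le> L"
      unfolding A(2)[OF i]
    proof (rule Max.boundedI)
      fix a assume "a \<in> insert (- L) ((\<lambda>p. f (fst p) (snd p) i - K * \<rho> \<mu> x p) ` P)"
      then show "a \<le> L"
      proof
        assume "a \<in> (\<lambda>p. f (fst p) (snd p) i - K * \<rho> \<mu> x p) ` P"
        then obtain p where p: "p \<in> P" "a = f (fst p) (snd p) i - K * \<rho> \<mu> x p" by blast
        have "0 \<le> K * \<rho> \<mu> x p" using K(1) \<rho>0 by simp
        then show ?thesis using pL[OF p(1) i] p(2) by linarith
      qed (use L in simp)
    qed (use P(1) in auto)
    moreover have "- L \<le> A \<mu> x i"
      unfolding A(2)[OF i] using P(1) by (intro Max_ge) auto
    ultimately show "\<bar>A \<mu> x i\<bar> \<le> L" by linarith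
  qed
  then show ?thesis using A(1) by blast
qed

text \<open>Functions on \<open>nat\<close> carry the product topology, so continuity is checked by
  coordinate: Lipschitz below \<open>n\<close>, constantly 0 from \<open>n\<close> on.\<close>

lemma measurable_token_graph:
  fixes \<Omega> :: "(real^'d::finite) set"
  assumes \<mu>: "\<mu> \<in> PX (Xset \<Omega> n L)" and range: "\<And>x. x \<in> closure \<Omega> \<Longrightarrow> f x \<in> Ybox n L"
    and lip: "\<And>x x'. x \<in> closure \<Omega> \<Longrightarrow> x' \<in> closure \<Omega> \<Longrightarrow> ydist n (f x) (f x') \<le> C * norm (x - x')"
  shows "(\<lambda>z. (fst z, f (fst z))) \<in> measurable (restrict_space \<mu> (Xset \<Omega> n L)) borel"
proof -
  have c: "continuous_on (closure \<Omega>) (\<lambda>x. f x i)" for i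
  proof (cases "i < n")
    case True
    have "\<bar>C\<bar>-lipschitz_on (closure \<Omega>) (\<lambda>x. f x i)"
    proof (rule lipschitz_onI)
      fix x x' assume x: "x \<in> closure \<Omega>" "x' \<in> closure \<Omega>"
      have "\<bar>f x i - f x' i\<bar> \<le> C * norm (x - x')"
        using abs_le_ydist[OF True, of "f x" "f x'"] lip[OF x] by linarith
      also have "\<dots> \<le> \<bar>C\<bar> * norm (x - x')" by (rule mult_right_mono) auto
      finally show "dist (f x i) (f x' i) \<le> \<bar>C\<bar> * dist x x'" by (simp add: dist_norm)
    qed simp
    then show ?thesis by (rule lipschitz_on_continuous_on)
  next
    case False
    then have "f x i = 0" if "x \<in> closure \<Omega>" for x using range[OF that] by (simp add: Ybox_def)
    then show ?thesis by (simp cong: continuous_on_cong)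
  qed
  have "continuous_on (Xset \<Omega> n L) (\<lambda>z. (fst z, f (fst z)))"
    by (intro continuous_intros continuous_on_compose2[OF c]) (auto simp: Xset_def)
  then show ?thesis
    using borel_measurable_continuous_on_restrict prob_space_restrict_PX(4)[OF \<mu>]
    by (simp cong: measurable_cong_sets)
qed

theorem theorem4p1:
  fixes \<Omega> :: "(real^'d) set"
    and L :: real and n :: nat
    and phat :: "'d pt measure \<Rightarrow> real^'d \<Rightarrow> (nat \<Rightarrow> real)"
    and \<epsilon> :: real
  assumes dom: "(open \<Omega> \<and> bounded \<Omega> \<and> smooth_boundary \<Omega>) \<or> \<Omega> = box 0 One"
    and L_pos: "L > 0" and n_pos: "n > 0"
    and range: "\<And>\<mu> x. \<mu> \<in> PX (Xset \<Omega> n L) \<Longrightarrow> x \<in> closure \<Omega> \<Longrightarrow> phat \<mu> x \<in> Ybox n L"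
    and unif_cont: "\<forall>e>0. \<exists>\<delta>>0. \<forall>\<mu>\<in>PX (Xset \<Omega> n L). \<forall>\<nu>\<in>PX (Xset \<Omega> n L). \<forall>x\<in>closure \<Omega>.
         W1 n \<mu> \<nu> < ennreal \<delta> \<longrightarrow> ydist n (phat \<mu> x) (phat \<nu> x) < e"
    and lip: "\<exists>C. \<forall>\<mu>\<in>PX (Xset \<Omega> n L). \<forall>x\<in>closure \<Omega>. \<forall>x'\<in>closure \<Omega>.
         ydist n (phat \<mu> x) (phat \<mu> x') \<le> C * norm (x - x')"
    and cont: "\<forall>\<mu>\<in>PX (Xset \<Omega> n L). \<forall>z\<in>Xset \<Omega> n L. \<forall>e>0. \<exists>\<delta>>0.
         \<forall>\<nu>\<in>PX (Xset \<Omega> n L). \<forall>z'\<in>Xset \<Omega> n L.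
           W1 n \<mu> \<nu> < ennreal \<delta> \<and> pdist n z z' < \<delta> \<longrightarrow>
           pdist n (fst z', phat \<nu> (fst z')) (fst z, phat \<mu> (fst z)) < e"
    and eps: "0 < \<epsilon>" "\<epsilon> < 1"
  shows "\<exists>J::nat. \<exists>y0. \<exists>\<theta> \<xi>. J > 0 \<and> y0 \<in> Ybox n L \<and>
    (let din = (\<lambda>l. if l = 1 \<or> l = J + 1 then n else 4 * CARD('d) + 4 * n);
         dmid = (\<lambda>l. 4 * CARD('d) + 4 * n);
         \<Gamma>tran = (\<lambda>\<mu> z. tstack din dmid \<theta> \<xi> J \<mu> (fst z, y0));
         Gtran = (\<lambda>\<mu>. pushX (Xset \<Omega> n L) \<mu> (\<Gamma>tran \<mu>));
         Ghat = (\<lambda>\<mu>. pushX (Xset \<Omega> n L) \<mu> (\<lambda>z. (fst z, phat \<mu> (fst z))))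
     in (\<forall>\<mu>\<in>PX (Xset \<Omega> n L). Gtran \<mu> \<in> PX (Xset \<Omega> n L)) \<and>
        (\<forall>\<mu>\<in>PX (Xset \<Omega> n L). W1 n (Gtran \<mu>) (Ghat \<mu>) \<le> ennreal \<epsilon>) \<and>
        (\<forall>\<mu> x y y'. fst (\<Gamma>tran \<mu> (x, y)) = x \<and> \<Gamma>tran \<mu> (x, y) = \<Gamma>tran \<mu> (x, y')))"
proof -
  let ?X = "Xset \<Omega> n L"
  have bdd: "bounded \<Omega>" using dom by auto
  \<comment> \<open>Each of the n coordinates may err by \<open>2 * e\<close>; the errors add up to
    \<open>\<epsilon>\<close>.\<close>
  define e where "e = \<epsilon> / (2 * n)"
  have e: "0 < e" using eps n_pos by (simp add: e_def)
  obtain A where "computable n A" and A: "\<And>\<mu> x i. \<mu> \<in> PX ?X \<Longrightarrow> x \<in> closure \<Omega> \<Longrightarrow> i < n \<Longrightarrow>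
    \<bar>A \<mu> x i\<bar> \<le> L \<and> \<bar>A \<mu> x i - phat \<mu> x i\<bar> \<le> 2 * e"
    using computable_approximation[OF bdd L_pos n_pos e range unif_cont lip] by blast
  let ?T = "\<lambda>J. tstack (\<lambda>l. if l = 1 \<or> l = J + 1 then n else 4 * CARD('d) + 4 * n) (\<lambda>l. 4 * CARD('d) + 4 * n)"
  obtain J \<theta> \<xi> where J: "0 < J" and T': "\<forall>\<mu>. prob_space \<mu> \<longrightarrow> sets \<mu> = sets borel \<longrightarrow>
      ?T J \<theta> \<xi> J \<mu> \<in> borel_measurable borel \<and>
      (\<forall>z. ?T J \<theta> \<xi> J \<mu> z = (fst z, \<lambda>i. if i < n then A \<mu> (fst z) i else 0))"
    using computable_realized[OF \<open>computable n A\<close>] unfolding Let_def by (elim exE conjE)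
  note T = T'[rule_format, THEN conjunct1] T'[rule_format, THEN conjunct2, rule_format]
  define \<Gamma> where "\<Gamma> = (\<lambda>\<mu> (z :: 'd pt). tstack (\<lambda>l. if l = 1 \<or> l = J + 1 then n else 4 * CARD('d) + 4 * n)
    (\<lambda>l. 4 * CARD('d) + 4 * n) \<theta> \<xi> J \<mu> (fst z, \<lambda>_. 0))"
  \<comment> \<open>The realized map depends on the query only through x, so any point of the box
    could serve as \<open>y0\<close>.\<close>
  have y0: "(\<lambda>_. 0) \<in> Ybox n L" using L_pos by (simp add: Ybox_def)
  have pX: "prob_space \<mu>" "sets \<mu> = sets borel" if "\<mu> \<in> PX ?X" for \<mu>
    using that by (auto simp: PX_def)
  have \<Gamma>: "\<Gamma> \<mu> z = (fst z, \<lambda>i. if i < n then A \<mu> (fst z) i else 0)" if "\<mu> \<in> PX ?X" for \<mu> z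
    unfolding \<Gamma>_def by (simp only: T(2)[OF pX[OF that]] fst_conv)
  have meas: "\<Gamma> \<mu> \<in> measurable (restrict_space \<mu> ?X) borel" if \<mu>: "\<mu> \<in> PX ?X" for \<mu>
  proof -
    have "(\<lambda>z :: 'd pt. (fst z, (\<lambda>_. 0) :: nat \<Rightarrow> real)) \<in> borel_measurable borel"
      by (intro borel_measurable_continuous_onI continuous_intros)
    from measurable_compose[OF this T(1)[OF pX[OF \<mu>]]] have "\<Gamma> \<mu> \<in> measurable borel borel"
      by (simp add: \<Gamma>_def)
    then have "\<Gamma> \<mu> \<in> measurable \<mu> borel"
      using pX(2)[OF \<mu>] by (simp cong: measurable_cong_sets)
    then show ?thesis by (rule measurable_restrict_space1)
  qed
  have "pushX ?X \<mu> (\<Gamma> \<mu>) \<in> PX ?X" if \<mu>: "\<mu> \<in> PX ?X" for \<mu>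
    using A[OF \<mu>] by (intro pushX_in_PX \<mu> meas) (auto simp: \<Gamma>[OF \<mu>] Xset_def Ybox_def)
  moreover have "W1 n (pushX ?X \<mu> (\<Gamma> \<mu>)) (pushX ?X \<mu> (\<lambda>z. (fst z, phat \<mu> (fst z)))) \<le> ennreal \<epsilon>"
    if \<mu>: "\<mu> \<in> PX ?X" for \<mu>
  proof (rule W1_pushX_le[OF \<mu> meas[OF \<mu>]])
    obtain C where C: "\<And>x x'. x \<in> closure \<Omega> \<Longrightarrow> x' \<in> closure \<Omega> \<Longrightarrow> ydist n (phat \<mu> x) (phat \<mu> x') \<le> C * norm (x - x')"
      using lip \<mu> by blast
    show "(\<lambda>z. (fst z, phat \<mu> (fst z))) \<in> measurable (restrict_space \<mu> ?X) borel"
      by (rule measurable_token_graph[where f = "phat \<mu>", OF \<mu> range[OF \<mu>] C])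
    fix z assume z: "z \<in> ?X"
    have "pdist n (\<Gamma> \<mu> z) (fst z, phat \<mu> (fst z)) \<le> (\<Sum>i<n. \<bar>A \<mu> (fst z) i - phat \<mu> (fst z) i\<bar>)"
      using pdist_le_l1dist[of n "\<Gamma> \<mu> z" "(fst z, phat \<mu> (fst z))"] by (simp add: \<Gamma>[OF \<mu>] l1dist_def)
    also have "\<dots> \<le> (\<Sum>i<n. 2 * e)"
      using A[OF \<mu>, of "fst z"] z by (intro sum_mono) (auto simp: Xset_def)
    also have "\<dots> = \<epsilon>" using n_pos by (simp add: e_def)
    finally show "pdist n (\<Gamma> \<mu> z) (fst z, phat \<mu> (fst z)) \<le> \<epsilon>" .
  qed
  moreover have "fst (\<Gamma> \<mu> (x, y)) = x \<and> \<Gamma> \<mu> (x, y) = \<Gamma> \<mu> (x, y')" for \<mu> x y y'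
    by (simp add: \<Gamma>_def fst_tstack)
  ultimately show ?thesis
    using J y0 unfolding Let_def \<Gamma>_def
    by (intro exI[of _ J] exI[of _ "\<lambda>_. 0"] exI[of _ \<theta>] exI[of _ \<xi>]) blast
qed

end
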